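(* Let $d=2n+1\ge 3$ be an odd integer and let $\mu$ be a finite complex Borel measure on $\mathbb{R}^d$ with compact support. Let $\mathbf{H}_\mu$ be the matrix with entries $\int f_\alpha\overline{f_\beta}\,d\mu$, where $(f_\alpha)$ runs over a system of harmonic polynomials on $\mathbb{R}^d$ spanning the space of all harmonic polynomials. If $\mathbf{H}_\mu$ has finite rank $m$, then $\operatorname{supp}\mu$ consists of at most $m$ points.
   Context: The rank of $\mathbf{H}_\mu$ does not depend on the choice of the spanning system of harmonic polynomials. *)

theory Defs
  imports "HOL-Analysis.Analysis"
begin

definition poly_fun :: "(real^'n \<Rightarrow> complex) \<Rightarrow> bool" where
  "poly_fun p \<longleftrightarrow> (\<exists>(K :: ('n \<Rightarrow> nat) set) c. finite K \<and>
      p = (\<lambda>x. \<Sum>k\<in>K. c k * (\<Prod>i\<in>UNIV. complex_of_real ((x $ i) ^ k i))))"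

definition partial_deriv :: "'n \<Rightarrow> (real^'n \<Rightarrow> complex) \<Rightarrow> real^'n \<Rightarrow> complex" where
  "partial_deriv i f x = vector_derivative (\<lambda>t::real. f (x + t *\<^sub>R axis i 1)) (at 0)"

definition laplacian :: "(real^'n \<Rightarrow> complex) \<Rightarrow> real^'n \<Rightarrow> complex" where
  "laplacian f x = (\<Sum>i\<in>UNIV. partial_deriv i (partial_deriv i f) x)"

definition harmonic_poly :: "(real^'n \<Rightarrow> complex) \<Rightarrow> bool" where
  "harmonic_poly p \<longleftrightarrow> poly_fun p \<and> (\<forall>x. laplacian p x = 0)"

definition spans_harmonic :: "('i \<Rightarrow> real^'n \<Rightarrow> complex) \<Rightarrow> bool" where
  "spans_harmonic f \<longleftrightarrow> (\<forall>a. harmonic_poly (f a)) \<and>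
     (\<forall>p. harmonic_poly p \<longrightarrow>
        (\<exists>S c. finite S \<and> p = (\<lambda>x. \<Sum>a\<in>S. c a * f a x)))"

text \<open>A complex Borel measure is represented as h dM, M a finite positive Borel measure,
  h an M-integrable complex density: mu(A) = integral over A of h dM.
  Its support: points every neighbourhood of which contains a Borel set of nonzero mu-measure
  (i.e. of positive total variation).\<close>
definition cmeasure_support :: "(real^'n) measure \<Rightarrow> (real^'n \<Rightarrow> complex) \<Rightarrow> (real^'n) set" where
  "cmeasure_support M h = {x. \<forall>e>0. \<exists>A\<in>sets borel. A \<subseteq> ball x e \<and>
       (LINT y:A|M. h y) \<noteq> 0}"

definition H_matrix :: "(real^'n) measure \<Rightarrow> (real^'n \<Rightarrow> complex) \<Rightarrow> ('i \<Rightarrow> real^'n \<Rightarrow> complex)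
    \<Rightarrow> 'i \<Rightarrow> 'i \<Rightarrow> complex" where
  "H_matrix M h f a b = (LINT x|M. f a x * cnj (f b x) * h x)"

definition rows_indep :: "('i \<Rightarrow> 'j \<Rightarrow> complex) \<Rightarrow> 'i set \<Rightarrow> bool" where
  "rows_indep H S \<longleftrightarrow> finite S \<and>
     (\<forall>c. (\<forall>b. (\<Sum>a\<in>S. c a * H a b) = 0) \<longrightarrow> (\<forall>a\<in>S. c a = 0))"

definition has_rank :: "('i \<Rightarrow> 'j \<Rightarrow> complex) \<Rightarrow> nat \<Rightarrow> bool" where
  "has_rank H m \<longleftrightarrow> (\<exists>S. rows_indep H S \<and> card S = m) \<and>
     (\<forall>S. rows_indep H S \<longrightarrow> card S \<le> m)"

end

theory Submission
  imports Defs "HOL-Complex_Analysis.Cauchy_Integral_Formula" "Jordan_Normal_Form.Determinant"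
begin

text \<open>
  For orthogonal \<open>\<xi>, \<eta>\<close> of equal length put \<open>z(x) = \<xi>\<bullet>x + \<i> \<eta>\<bullet>x\<close>; every polynomial in \<open>z\<close> is
  harmonic, so the moments \<open>\<integral> z\<^sup>j cnj(z)\<^sup>k d\<mu>\<close> form a matrix of rank at most \<open>m\<close>. Choose polynomials
  \<open>f\<^sub>i, g\<^sub>j\<close> giving a nonvanishing minor of maximal size. For any polynomials \<open>\<phi>\<^sub>i\<close> the function
  \<open>a \<mapsto> det(\<integral> \<phi>\<^sub>i e\<^bsup>az\<^esup> cnj(g\<^sub>j) d\<mu>) \<cdot> cnj(det(\<integral> f\<^sub>i cnj(g\<^sub>j e\<^bsup>-az\<^esup>) d\<mu>))\<close> is entire, and by the rank condition it is
  bounded, so it is constant by Liouville. Taking \<open>\<phi> = f\<close> shows that both factors never vanish; replacing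
  one \<open>f\<^sub>i\<close> by a polynomial \<open>q\<close> of degree at most \<open>m\<close> in the left kernel of the moment form then gives
  \<open>\<integral> q(z) e\<^bsup>az\<^esup> cnj(e\<^bsup>-az\<^esup>) d\<mu> = 0\<close> for all \<open>a\<close>, i.e. the image of \<open>\<mu>\<close> under \<open>z\<close> lives on the zeros of \<open>q\<close>.

  By Fubini, for almost every \<open>\<xi>\<close> the map \<open>x \<mapsto> \<xi>\<bullet>x\<close> separates almost all pairs of distinct points, so
  each of its fibres carries at most one atom and nothing else. Hence there are at most \<open>m\<close> atoms, and
  the rest of \<open>\<mu>\<close> has Fourier transform zero at almost every \<open>\<xi>\<close>, therefore everywhere.
\<close>

subsection \<open>Determinants of finite complex matrices indexed by natural numbers\<close>

text \<open>Entries are given by a plain function, of which only the values at indices below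
  \<open>r\<close> count. Rows can thus be replaced by function update, and entries may depend on a
  parameter.\<close>

definition sq_det :: "nat \<Rightarrow> (nat \<Rightarrow> nat \<Rightarrow> complex) \<Rightarrow> complex" where
  "sq_det r A = Determinant.det (Matrix.mat r r (\<lambda>(i, j). A i j))"

lemma sq_det_cong:
  assumes "\<And>i j. i < r \<Longrightarrow> j < r \<Longrightarrow> A i j = B i j"
  shows "sq_det r A = sq_det r B"
proof -
  have "Matrix.mat r r (\<lambda>(i, j). A i j) = Matrix.mat r r (\<lambda>(i, j). B i j)"
    using assms by (intro eq_matI) auto
  then show ?thesis by (simp add: sq_det_def)
qed

lemma sq_det_expand:
  "sq_det r A = (\<Sum>p | p permutes {0..<r}. signof p * (\<Prod>i = 0..<r. A i (p i)))"
proof -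
  have "p i < r" if "p permutes {0..<r}" "i < r" for p i
    using permutes_in_image[OF that(1)] that(2) by simp
  then show ?thesis
    unfolding sq_det_def by (subst det_def'[where n = r]) (auto intro!: sum.cong prod.cong)
qed

lemma sq_det_mult:
  "sq_det r (\<lambda>i j. \<Sum>k<r. A i k * B k j) = sq_det r A * sq_det r B"
proof -
  have "Matrix.mat r r (\<lambda>(i, j). \<Sum>k<r. A i k * B k j) =
      Matrix.mat r r (\<lambda>(i, j). A i j) * Matrix.mat r r (\<lambda>(i, j). B i j)"
    by (intro eq_matI) (auto simp: scalar_prod_def atLeast0LessThan intro!: sum.cong)
  then show ?thesis
    unfolding sq_det_def by (simp add: det_mult[where n = r])
qed

text \<open>The rank hypothesis supplies dependences among rows, so the vector acts from the left.
  The known criterion is about vectors acting from the right, hence the passage to the transpose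
  \<open>?T\<close>.\<close>

lemma sq_det_eq_0_iff:
  "sq_det r A = 0 \<longleftrightarrow> (\<exists>v. (\<exists>i<r. v i \<noteq> 0) \<and> (\<forall>j<r. (\<Sum>i<r. v i * A i j) = 0))"
proof -
  let ?T = "Matrix.mat r r (\<lambda>(j, i). A i j)"
  have T: "?T \<in> carrier_mat r r" by simp
  have tr: "transpose_mat ?T = Matrix.mat r r (\<lambda>(i, j). A i j)"
    by (intro eq_matI) auto
  have mv: "?T *\<^sub>v v = 0\<^sub>v r \<longleftrightarrow> (\<forall>j<r. (\<Sum>i<r. vec_index v i * A i j) = 0)"
    if "v \<in> carrier_vec r" for v
    using that
    by (auto simp: vec_eq_iff scalar_prod_def atLeast0LessThan mult.commute)
  have "sq_det r A = Determinant.det ?T"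
    unfolding sq_det_def tr[symmetric] by (rule det_transpose[OF T])
  then have "sq_det r A = 0 \<longleftrightarrow>
      (\<exists>v. v \<in> carrier_vec r \<and> v \<noteq> 0\<^sub>v r \<and> ?T *\<^sub>v v = 0\<^sub>v r)"
    using det_0_iff_vec_prod_zero_field[OF T] by simp
  also have "\<dots> \<longleftrightarrow> (\<exists>v. (\<exists>i<r. v i \<noteq> 0) \<and> (\<forall>j<r. (\<Sum>i<r. v i * A i j) = 0))"
  proof
    assume "\<exists>v. v \<in> carrier_vec r \<and> v \<noteq> 0\<^sub>v r \<and> ?T *\<^sub>v v = 0\<^sub>v r"
    then obtain v where v: "v \<in> carrier_vec r" "v \<noteq> 0\<^sub>v r" "?T *\<^sub>v v = 0\<^sub>v r" by blast
    then show "\<exists>v. (\<exists>i<r. v i \<noteq> 0) \<and> (\<forall>j<r. (\<Sum>i<r. v i * A i j) = 0)"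
      using mv[OF v(1)] by (intro exI[of _ "vec_index v"]) (auto simp: vec_eq_iff)
  next
    assume "\<exists>v. (\<exists>i<r. v i \<noteq> 0) \<and> (\<forall>j<r. (\<Sum>i<r. v i * A i j) = 0)"
    then obtain v where v: "\<exists>i<r. v i \<noteq> 0" "\<forall>j<r. (\<Sum>i<r. v i * A i j) = 0" by blast
    then show "\<exists>v. v \<in> carrier_vec r \<and> v \<noteq> 0\<^sub>v r \<and> ?T *\<^sub>v v = 0\<^sub>v r"
      using mv[of "Matrix.vec r v"] by (intro exI[of _ "Matrix.vec r v"]) (auto simp: vec_eq_iff)
  qed
  finally show ?thesis .
qed

lemma sq_det_inverse:
  assumes "sq_det r A \<noteq> 0"
  obtains G where "\<And>i j. i < r \<Longrightarrow> j < r \<Longrightarrow> (\<Sum>k<r. A i k * G k j) = (if i = j then 1 else 0)"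
    and "sq_det r G \<noteq> 0"
proof -
  let ?A = "Matrix.mat r r (\<lambda>(i, j). A i j)"
  have A: "?A \<in> carrier_mat r r" by simp
  have "Determinant.det ?A \<noteq> 0" using assms by (simp add: sq_det_def)
  \<comment> \<open>\<open>()\<close> fills the extension slot of the ring record and carries no
    information.\<close>
  from det_non_zero_imp_unit[OF A this, of "()"]
  obtain B where B: "B \<in> carrier_mat r r" "?A * B = 1\<^sub>m r"
    unfolding Units_def by (auto simp: ring_mat_def)
  define G where "G = (\<lambda>i j. B $$ (i, j))"
  have 1: "(\<Sum>k<r. A i k * G k j) = (if i = j then 1 else 0)" if "i < r" "j < r" for i j
  proof -
    have "(?A * B) $$ (i, j) = (\<Sum>k<r. A i k * G k j)"
      using that B(1) by (auto simp: scalar_prod_def G_def atLeast0LessThan intro!: sum.cong)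
    then show ?thesis using B(2) that by simp
  qed
  have "sq_det r A * sq_det r G = sq_det r (\<lambda>i j. if i = j then 1 else 0)"
    unfolding sq_det_mult[symmetric] by (rule sq_det_cong) (use 1 in simp)
  also have "\<dots> = 1"
  proof -
    have "Matrix.mat r r (\<lambda>(i, j). if i = j then 1 else 0) = (1\<^sub>m r :: complex mat)"
      by (intro eq_matI) auto
    then show ?thesis by (simp add: sq_det_def)
  qed
  finally show ?thesis using that 1 by force
qed

lemma sq_det_row_zero:
  assumes "k < r" "\<And>j. j < r \<Longrightarrow> A k j = 0"
  shows "sq_det r A = 0"
  unfolding sq_det_eq_0_iff
  by (rule exI[of _ "\<lambda>i. if i = k then 1 else 0"]) (use assms in \<open>auto simp: if_distrib[of "\<lambda>x. x * _"] sum.delta cong: if_cong\<close>)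

lemma sq_det_col_zero:
  assumes "k < r" "\<And>i. i < r \<Longrightarrow> A i k = 0"
  shows "sq_det r A = 0"
  unfolding sq_det_expand
proof (rule sum.neutral, rule ballI)
  fix p assume "p \<in> {p. p permutes {0..<r}}"
  then have "k \<in> p ` {0..<r}" using permutes_image[of p "{0..<r}"] assms(1) by auto
  then obtain i where "i < r" "p i = k" by auto
  then have "(\<Prod>i = 0..<r. A i (p i)) = 0" using assms(2) by (intro prod_zero bexI[of _ i]) auto
  then show "signof p * (\<Prod>i = 0..<r. A i (p i)) = 0" by simp
qed

text \<open>Cramer's rule: the coordinates of \<open>y\<close> in the basis of rows of \<open>A\<close> all vanish.\<close>
lemma sq_det_replace_rows_zero:
  assumes A: "sq_det r A \<noteq> 0" and zero: "\<And>k. k < r \<Longrightarrow> sq_det r (A(k := y)) = 0" and "j < r"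
  shows "y j = 0"
proof -
  obtain G where G: "\<And>i j. i < r \<Longrightarrow> j < r \<Longrightarrow> (\<Sum>k<r. A i k * G k j) = (if i = j then 1 else 0)"
    "sq_det r G \<noteq> 0"
    using sq_det_inverse[OF A] by blast
  \<comment> \<open>This sum is the coordinate of \<open>y\<close> on row \<open>k\<close> of
    \<open>A\<close>.\<close>
  have "(\<Sum>l<r. y l * G l k) = 0" if k: "k < r" for k
  proof -
    let ?c = "\<Sum>l<r. y l * G l k"
    obtain v where v: "\<exists>i<r. v i \<noteq> 0" "\<forall>j<r. (\<Sum>i<r. v i * (A(k := y)) i j) = 0"
      using zero[OF k] unfolding sq_det_eq_0_iff by blast
    \<comment> \<open>Multiplying the dependence \<open>v\<close> by \<open>G\<close> turns row
      \<open>i\<close> into a unit vector for \<open>i \<noteq> k\<close>, and row \<open>k\<close>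
      into the coordinate vector of \<open>y\<close>.\<close>
    have eq: "(if i = k then v k * (\<Sum>l<r. y l * G l m) else v i * (if i = m then 1 else 0)) =
        (\<Sum>j<r. v i * (A(k := y)) i j * G j m)" if "i < r" "m < r" for i m
      using G(1)[OF that] by (auto simp: mult.assoc simp flip: sum_distrib_left)
    have tot: "(\<Sum>i<r. if i = k then v k * (\<Sum>l<r. y l * G l m) else v i * (if i = m then 1 else 0)) = 0"
      if m: "m < r" for m
    proof -
      have "(\<Sum>i<r. if i = k then v k * (\<Sum>l<r. y l * G l m) else v i * (if i = m then 1 else 0))
          = (\<Sum>i<r. \<Sum>j<r. v i * (A(k := y)) i j * G j m)"
        using eq m by (intro sum.cong) auto
      also have "\<dots> = (\<Sum>j<r. (\<Sum>i<r. v i * (A(k := y)) i j) * G j m)"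
        by (subst sum.swap) (simp add: sum_distrib_right)
      also have "\<dots> = 0" using v(2) by simp
      finally show ?thesis .
    qed
    have split: "(\<Sum>i<r. if i = k then a else v i * (if i = m then 1 else 0)) =
       (if m = k then a else a + v m)" if "m < r" for m a
    proof -
      have "(\<Sum>i<r. if i = k then a else v i * (if i = m then 1 else 0)) =
        a + (\<Sum>i\<in>{..<r}-{k}. v i * (if i = m then 1 else 0))"
        using k by (subst sum.remove[of _ k]) (auto intro!: sum.cong)
      also have "(\<Sum>i\<in>{..<r}-{k}. v i * (if i = m then 1 else 0)) = (if m = k then 0 else v m)"
        using that by (auto simp: sum.delta if_distrib cong: if_cong)
      finally show ?thesis by simp
    qed
    have "v k * ?c = 0" using tot[OF k] split[OF k] by simp
    \<comment> \<open>With \<open>v k = 0\<close>, column \<open>m\<close> would read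
      \<open>v m = 0\<close> for every other \<open>m\<close>, and \<open>v\<close> would be
      trivial.\<close>
    moreover have "v k \<noteq> 0"
    proof
      assume "v k = 0"
      then have "v m = 0" if "m < r" for m using tot[OF that] split[OF that] by (cases "m = k") auto
      then show False using v(1) by blast
    qed
    ultimately show ?thesis by simp
  qed
  then have "\<forall>k<r. (\<Sum>l<r. y l * G l k) = 0" by blast
  \<comment> \<open>A nonzero \<open>y\<close> would be a dependence among the rows of the
    invertible \<open>G\<close>.\<close>
  moreover have "\<not> ((\<exists>i<r. y i \<noteq> 0) \<and> (\<forall>k<r. (\<Sum>l<r. y l * G l k) = 0))"
    using G(2) unfolding sq_det_eq_0_iff by blast
  ultimately show ?thesis using \<open>j < r\<close> by blast
qed

lemma cnj_sq_det: "cnj (sq_det r A) = sq_det r (\<lambda>i j. cnj (A i j))"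
  by (simp add: sq_det_expand sign_def)

lemma holomorphic_sq_det:
  assumes "\<And>i j. (\<lambda>a. A a i j) holomorphic_on S"
  shows "(\<lambda>a. sq_det r (A a)) holomorphic_on S"
  unfolding sq_det_expand by (intro holomorphic_intros assms)

lemma bounded_sq_det:
  assumes "\<And>i j. \<exists>C. \<forall>a. norm (A a i j) \<le> C"
  shows "\<exists>C. \<forall>a. norm (sq_det r (A a)) \<le> C"
proof -
  obtain C where C: "\<And>i j a. norm (A a i j) \<le> C i j"
    using assms by metis
  have "norm (sq_det r (A a)) \<le> (\<Sum>p | p permutes {0..<r}. \<Prod>i = 0..<r. C i (p i))" for a
    unfolding sq_det_expand
  proof (rule sum_norm_le)
    fix p
    have "norm (signof p :: complex) = 1" by (simp add: sign_def)
    then show "norm (signof p * (\<Prod>i = 0..<r. A a i (p i))) \<le> (\<Prod>i = 0..<r. C i (p i))"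
      using C by (auto simp: norm_mult prod_norm intro!: prod_mono simp flip: prod_norm)
  qed
  then show ?thesis by blast
qed

subsection \<open>Moments of finite rank in one complex variable\<close>

no_notation Matrix.vec_index (infixl "$" 100)
no_notation scalar_prod (infix "\<bullet>" 70)

text \<open>The exponential series is integrated term by term: where \<open>k\<close> does not
  vanish, \<open>z\<close> is bounded by \<open>R\<close>, so \<open>norm (k x)\<close> times a
  convergent exponential series dominates.\<close>

lemma exp_moment_sums:
  fixes z :: "'a \<Rightarrow> complex" and k :: "'a \<Rightarrow> complex"
  assumes k: "integrable M k" and z: "z \<in> borel_measurable M"
    and R: "\<And>x. x \<in> space M \<Longrightarrow> k x \<noteq> 0 \<Longrightarrow> norm (z x) \<le> R"
  shows "(\<lambda>n. a ^ n / fact n * (LINT x|M. z x ^ n * k x)) sums (LINT x|M. exp (a * z x) * k x)"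
proof -
  have kz: "norm (z x ^ n * k x) \<le> R ^ n * norm (k x)" if "x \<in> space M" for x n
    using R[OF that] by (cases "k x = 0") (auto simp: norm_mult norm_power intro!: mult_right_mono power_mono)
  have k': "k \<in> borel_measurable M" using k by simp
  have int: "integrable M (\<lambda>x. z x ^ n * k x)" for n
    by (rule Bochner_Integration.integrable_bound[of M "\<lambda>x. R ^ n * norm (k x)"])
       (use k z k' kz in \<open>auto intro!: AE_I2 order_trans[OF kz] abs_ge_self\<close>)
  let ?s = "\<lambda>n x. a ^ n / fact n * (z x ^ n * k x)"
  have pt: "(\<lambda>n. ?s n x) sums (exp (a * z x) * k x)" for x
  proof -
    have "(\<lambda>n. (a * z x) ^ n /\<^sub>R fact n * k x) sums (exp (a * z x) * k x)"
      by (rule sums_mult2[OF exp_converges])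
    then show ?thesis
      by (simp add: power_mult_distrib scaleR_conv_of_real field_simps)
  qed
  \<comment> \<open>The absolute value is taken because \<open>R\<close> can be negative when
    \<open>k\<close> vanishes on the whole space.\<close>
  have nrm: "norm (?s n x) \<le> norm (k x) * ((norm a * \<bar>R\<bar>) ^ n /\<^sub>R fact n)" if "x \<in> space M" for n x
  proof -
    have "norm (?s n x) \<le> norm a ^ n / fact n * (\<bar>R\<bar> ^ n * norm (k x))"
      unfolding norm_mult[of "a ^ n / fact n"]
      by (intro mult_mono order_trans[OF kz[OF that]] mult_right_mono)
         (auto simp: norm_divide norm_power power_abs[symmetric])
    then show ?thesis by (simp add: power_mult_distrib field_simps)
  qed
  have sm: "summable (\<lambda>n. (norm a * \<bar>R\<bar>) ^ n /\<^sub>R fact n :: real)"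
    using exp_converges sums_summable by blast
  have "(\<lambda>n. LINT x|M. ?s n x) sums (LINT x|M. (\<Sum>n. ?s n x))"
  proof (rule sums_integral)
    show "integrable M (?s n)" for n using int by simp
    show "AE x in M. summable (\<lambda>n. norm (?s n x))"
    proof (rule AE_I2)
      fix x assume "x \<in> space M"
      then show "summable (\<lambda>n. norm (?s n x))"
        by (intro summable_comparison_test'[OF summable_mult[OF sm]]) (use nrm in auto)
    qed
    show "summable (\<lambda>n. LINT x|M. norm (?s n x))"
    proof (rule summable_comparison_test'[OF summable_mult[OF sm]])
      fix n
      have "(LINT x|M. norm (?s n x)) \<le> (LINT x|M. norm (k x) * ((norm a * \<bar>R\<bar>) ^ n /\<^sub>R fact n))"
        by (rule integral_mono) (use int k nrm in auto)
      then show "norm (LINT x|M. norm (?s n x)) \<le> (LINT x|M. norm (k x)) * ((norm a * \<bar>R\<bar>) ^ n /\<^sub>R fact n)"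
        by simp
    qed
  qed
  moreover have "(\<Sum>n. ?s n x) = exp (a * z x) * k x" for x
    using pt sums_unique by metis
  ultimately show ?thesis by simp
qed

lemma exp_transform_holomorphic:
  fixes z :: "'a \<Rightarrow> complex" and k :: "'a \<Rightarrow> complex"
  assumes "integrable M k" "z \<in> borel_measurable M"
    and "\<And>x. x \<in> space M \<Longrightarrow> k x \<noteq> 0 \<Longrightarrow> norm (z x) \<le> R"
  shows "(\<lambda>a. LINT x|M. exp (a * z x) * k x) holomorphic_on UNIV"
proof -
  have "(\<lambda>n. (LINT x|M. z x ^ n * k x) / fact n * (a - 0) ^ n) sums (LINT x|M. exp (a * z x) * k x)" for a
    using exp_moment_sums[OF assms] by (simp add: field_simps)
  then have "(\<lambda>a. LINT x|M. exp (a * z x) * k x) holomorphic_on ball 0 r" for r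
    by (intro power_series_holomorphic[where a = "\<lambda>n. (LINT x|M. z x ^ n * k x) / fact n"]) blast
  then have "(\<lambda>a. LINT x|M. exp (a * z x) * k x) holomorphic_on (\<Union>r. ball 0 r)"
    by (intro holomorphic_on_UN_open) auto
  moreover have "(\<Union>r. ball (0::complex) r) = UNIV"
    using gt_ex by auto
  ultimately show ?thesis by simp
qed

text \<open>Where \<open>k\<close> does not vanish, only the values of \<open>G\<close> on a compact
  ball matter, and there \<open>G\<close> is bounded.\<close>

lemma integrable_comp_mult:
  fixes T :: "'a \<Rightarrow> 'e::euclidean_space" and k :: "'a \<Rightarrow> complex" and G :: "'e \<Rightarrow> complex"
  assumes k: "integrable M k" and T: "T \<in> borel_measurable M"
    and R: "\<And>x. x \<in> space M \<Longrightarrow> k x \<noteq> 0 \<Longrightarrow> norm (T x) \<le> R"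
    and G: "continuous_on UNIV G"
  shows "integrable M (\<lambda>x. G (T x) * k x)"
proof -
  have "compact (G ` cball 0 R)"
    by (intro compact_continuous_image continuous_on_subset[OF G]) auto
  then obtain C where "\<And>y. y \<in> G ` cball 0 R \<Longrightarrow> norm y \<le> C"
    using compact_imp_bounded bounded_pos by metis
  then have C: "\<And>w. norm w \<le> R \<Longrightarrow> norm (G w) \<le> C" by auto
  have [measurable]: "G \<in> borel_measurable borel" using G borel_measurable_continuous_onI by blast
  have [measurable]: "k \<in> borel_measurable M" "T \<in> borel_measurable M" using k T by auto
  show ?thesis
  proof (rule Bochner_Integration.integrable_bound[of M "\<lambda>x. C * norm (k x)"])
    show "AE x in M. norm (G (T x) * k x) \<le> norm (C * norm (k x))"
    proof (rule AE_I2)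
      fix x assume x: "x \<in> space M"
      show "norm (G (T x) * k x) \<le> norm (C * norm (k x))"
      proof (cases "k x = 0")
        case False
        then have "norm (G (T x)) \<le> C" using R[OF x] C by blast
        then show ?thesis by (auto simp: norm_mult intro!: mult_right_mono order_trans[OF _ abs_ge_self])
      qed simp
    qed
  qed (use k in auto)
qed

section \<open>The moment form in one complex variable and its annihilating polynomial\<close>

text \<open>The planar situation: \<open>h\<close> is the density and \<open>z\<close> the
  projection to a plane. The last assumption bounds the rank by \<open>m\<close>: any
  \<open>m + 1\<close> rows of the moment form are dependent, with coefficients that serve all
  columns \<open>g\<close> at once.\<close>

locale finite_rank_moments =
  fixes M :: "'a measure" and h z :: "'a \<Rightarrow> complex" and R :: real and m :: nat
  assumes h: "integrable M h" and z: "z \<in> borel_measurable M"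
    and R: "\<And>x. x \<in> space M \<Longrightarrow> h x \<noteq> 0 \<Longrightarrow> norm (z x) \<le> R"
    and rank: "\<And>f :: nat \<Rightarrow> complex poly. \<exists>c. (\<exists>i\<le>m. c i \<noteq> 0) \<and>
      (\<forall>g :: complex poly. (\<Sum>i\<le>m. c i * (LINT x|M. poly (f i) (z x) * cnj (poly g (z x)) * h x)) = 0)"
begin

text \<open>The arguments are functions rather than polynomials, since exponential factors are to be
  inserted in either slot.\<close>

definition B :: "(complex \<Rightarrow> complex) \<Rightarrow> (complex \<Rightarrow> complex) \<Rightarrow> complex" where
  "B \<phi> \<psi> = (LINT x|M. \<phi> (z x) * cnj (\<psi> (z x)) * h x)"

abbreviation twist :: "complex poly \<Rightarrow> complex \<Rightarrow> complex \<Rightarrow> complex" where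
  "twist p a w \<equiv> poly p w * exp (a * w)"

lemma integrable_B:
  assumes "continuous_on UNIV (\<phi> :: complex \<Rightarrow> complex)"
  shows "integrable M (\<lambda>x. \<phi> (z x) * h x)"
  by (rule integrable_comp_mult[OF h z R assms])

lemma B_sums_left:
  assumes \<phi>: "continuous_on UNIV (\<phi> :: complex \<Rightarrow> complex)" and \<psi>: "continuous_on UNIV (\<psi> :: complex \<Rightarrow> complex)"
  shows "(\<lambda>n. a ^ n / fact n * B (\<lambda>w. \<phi> w * w ^ n) \<psi>) sums B (\<lambda>w. \<phi> w * exp (a * w)) \<psi>"
proof -
  have "integrable M (\<lambda>x. (\<lambda>w. \<phi> w * cnj (\<psi> w)) (z x) * h x)"
    by (rule integrable_B) (intro continuous_intros \<phi> \<psi>)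
  from exp_moment_sums[OF this z, of R a] R show ?thesis
    by (simp add: B_def mult_ac)
qed

text \<open>The second slot is conjugated, so the expansion runs in powers of
  \<open>cnj a\<close>.\<close>

lemma B_sums_right:
  assumes \<phi>: "continuous_on UNIV (\<phi> :: complex \<Rightarrow> complex)" and \<psi>: "continuous_on UNIV (\<psi> :: complex \<Rightarrow> complex)"
  shows "(\<lambda>n. cnj a ^ n / fact n * B \<phi> (\<lambda>w. \<psi> w * w ^ n)) sums B \<phi> (\<lambda>w. \<psi> w * exp (a * w))"
proof -
  have "integrable M (\<lambda>x. (\<lambda>w. \<phi> w * cnj (\<psi> w)) (z x) * h x)"
    by (rule integrable_B) (intro continuous_intros \<phi> \<psi>)
  moreover have "(\<lambda>x. cnj (z x)) \<in> borel_measurable M" 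
    using z by (rule measurable_compose[OF _ borel_measurable_continuous_onI]) (intro continuous_intros)
  ultimately show ?thesis
    using exp_moment_sums[of M "\<lambda>x. (\<lambda>w. \<phi> w * cnj (\<psi> w)) (z x) * h x" "\<lambda>x. cnj (z x)" R "cnj a"] R
    by (simp add: B_def mult_ac exp_cnj)
qed

lemma holomorphic_B_left:
  "(\<lambda>a. B (twist p a) (poly q)) holomorphic_on UNIV"
proof -
  have "integrable M (\<lambda>x. (\<lambda>w. poly p w * cnj (poly q w)) (z x) * h x)"
    by (rule integrable_B) (intro continuous_intros)
  from exp_transform_holomorphic[OF this z, of R] R show ?thesis
    by (simp add: B_def mult_ac)
qed

text \<open>The outer conjugation undoes the antiholomorphic dependence on \<open>a\<close> in the
  second slot.\<close>

lemma holomorphic_B_right: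
  "(\<lambda>a. cnj (B (poly p) (twist q (-a)))) holomorphic_on UNIV"
proof -
  have "integrable M (\<lambda>x. cnj ((\<lambda>w. poly p w * cnj (poly q w)) (z x) * h x))"
    by (intro integrable_cnj integrable_B continuous_intros)
  from exp_transform_holomorphic[OF this, of "\<lambda>x. - z x" R] z R show ?thesis
    by (simp add: B_def mult_ac exp_cnj flip: Bochner_Integration.integral_cnj)
qed

text \<open>The factor \<open>exp (a * w) * cnj (exp (- a * w))\<close> is the exponential of a
  purely imaginary number, so it drops out of the modulus of the integrand.\<close>

lemma bounded_B_twist:
  "\<exists>C. \<forall>a. norm (B (twist p a) (twist q (-a))) \<le> C"
proof -
  have int: "integrable M (\<lambda>x. (\<lambda>w. poly p w * cnj (poly q w)) (z x) * h x)"
    by (rule integrable_B) (intro continuous_intros)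
  have "norm (B (twist p a) (twist q (-a))) \<le> (LINT x|M. norm ((\<lambda>w. poly p w * cnj (poly q w)) (z x) * h x))" for a
  proof -
    have "norm (exp (a * w) * cnj (exp (- a * w))) = 1" for w
      by (simp add: norm_mult norm_exp_eq_Re complex_mod_cnj flip: exp_add)
    then have "norm (twist p a (z x) * cnj (twist q (-a) (z x)) * h x) =
       norm ((\<lambda>w. poly p w * cnj (poly q w)) (z x) * h x)" for x
      by (simp add: norm_mult mult_ac norm_exp_eq_Re flip: exp_add)
    then show ?thesis unfolding B_def
      by (intro order_trans[OF integral_norm_bound]) simp
  qed
  then show ?thesis by blast
qed

text \<open>Take a nonvanishing minor of maximal size \<open>r\<close>. All minors bordering it
  vanish, so each row of the form is a combination of the rows \<open>f i\<close>; the inverse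
  \<open>G\<close> of the minor recovers the coefficients from the columns
  \<open>g l\<close>.\<close>

lemma full_rank_minor:
  obtains r f g G where
    "sq_det r (\<lambda>i j. B (poly (f i)) (poly (g j))) \<noteq> 0" and "sq_det r G \<noteq> 0"
    and "\<And>p q. B (poly p) (poly q) =
      (\<Sum>i<r. (\<Sum>l<r. B (poly p) (poly (g l)) * G l i) * B (poly (f i)) (poly q))"
proof -
  define D where "D n \<longleftrightarrow> (\<exists>f g. sq_det n (\<lambda>i j. B (poly (f i)) (poly (g j))) \<noteq> 0)" for n
  have D0: "D 0" by (simp add: D_def sq_det_expand)
  \<comment> \<open>More than \<open>m\<close> rows are dependent: coefficients for the first
    \<open>m + 1\<close> of them are extended by zero.\<close>
  have D_le: "n \<le> m" if "D n" for n
  proof (rule ccontr)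
    assume "\<not> n \<le> m"
    from \<open>D n\<close> obtain f g where fg: "sq_det n (\<lambda>i j. B (poly (f i)) (poly (g j))) \<noteq> 0"
      unfolding D_def by blast
    obtain c where c: "\<exists>i\<le>m. c i \<noteq> 0" "\<And>q. (\<Sum>i\<le>m. c i * B (poly (f i)) (poly q)) = 0"
      using rank[of f] unfolding B_def by blast
    have "(\<Sum>i<n. (if i \<le> m then c i else 0) * B (poly (f i)) (poly q)) = 0" for q
    proof -
      have "(\<Sum>i<n. (if i \<le> m then c i else 0) * B (poly (f i)) (poly q)) =
          (\<Sum>i\<le>m. c i * B (poly (f i)) (poly q))"
        using \<open>\<not> n \<le> m\<close> by (intro sum.mono_neutral_cong_right) auto
      then show ?thesis using c(2) by simp
    qed
    moreover obtain i where "i \<le> m" "c i \<noteq> 0" using c(1) by blast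
    then have "\<exists>i<n. (if i \<le> m then c i else 0) \<noteq> 0"
      using \<open>\<not> n \<le> m\<close> by (intro exI[of _ i]) simp
    ultimately have "sq_det n (\<lambda>i j. B (poly (f i)) (poly (g j))) = 0"
      unfolding sq_det_eq_0_iff by (intro exI[of _ "\<lambda>i. if i \<le> m then c i else 0"]) simp
    then show False using fg by simp
  qed
  define r where "r = Greatest D"
  have "D r" unfolding r_def using D0 D_le by (rule GreatestI_nat)
  have "\<not> D (Suc r)"
    using Greatest_le_nat[of D "Suc r" m] D_le unfolding r_def by auto
  from \<open>D r\<close> obtain f g where fg: "sq_det r (\<lambda>i j. B (poly (f i)) (poly (g j))) \<noteq> 0"
    unfolding D_def by blast
  obtain G where G: "\<And>i j. i < r \<Longrightarrow> j < r \<Longrightarrow>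
        (\<Sum>k<r. B (poly (f i)) (poly (g k)) * G k j) = (if i = j then 1 else 0)"
      and G0: "sq_det r G \<noteq> 0"
    using sq_det_inverse[OF fg] by blast
  show thesis
  proof (rule that[OF fg G0])
    fix p q
    \<comment> \<open>\<open>p\<close> and \<open>q\<close> border the chosen minor by one row and
      one column.\<close>
    let ?f = "f(r := p)" and ?g = "g(r := q)"
    have "sq_det (Suc r) (\<lambda>i j. B (poly (?f i)) (poly (?g j))) = 0"
      using \<open>\<not> D (Suc r)\<close> unfolding D_def by blast
    then obtain v where v: "\<exists>i<Suc r. v i \<noteq> 0"
      "\<And>j. j < Suc r \<Longrightarrow> (\<Sum>i<Suc r. v i * B (poly (?f i)) (poly (?g j))) = 0"
      unfolding sq_det_eq_0_iff by blast
    have v1: "(\<Sum>i<r. v i * B (poly (f i)) (poly (g j))) + v r * B (poly p) (poly (g j)) = 0" if "j < r" for j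
      using v(2)[of j] that by simp
    have v2: "(\<Sum>i<r. v i * B (poly (f i)) (poly q)) + v r * B (poly p) (poly q) = 0"
      using v(2)[of r] by simp
    have "v r \<noteq> 0"
    proof
      assume "v r = 0"
      then have "\<forall>j<r. (\<Sum>i<r. v i * B (poly (f i)) (poly (g j))) = 0" using v1 by simp
      moreover have "\<exists>i<r. v i \<noteq> 0" using v(1) \<open>v r = 0\<close> by (auto simp: less_Suc_eq)
      ultimately show False using fg unfolding sq_det_eq_0_iff by blast
    qed
    define w where "w i = - v i / v r" for i
    have w1: "B (poly p) (poly (g j)) = (\<Sum>i<r. w i * B (poly (f i)) (poly (g j)))" if "j < r" for j
    proof -
      have "v r * B (poly p) (poly (g j)) = - (\<Sum>i<r. v i * B (poly (f i)) (poly (g j)))"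
        using v1[OF that] by (simp add: eq_neg_iff_add_eq_0 add.commute)
      then show ?thesis using \<open>v r \<noteq> 0\<close>
        by (simp add: w_def sum_negf field_simps flip: sum_divide_distrib)
    qed
    have w2: "B (poly p) (poly q) = (\<Sum>i<r. w i * B (poly (f i)) (poly q))"
    proof -
      have "v r * B (poly p) (poly q) = - (\<Sum>i<r. v i * B (poly (f i)) (poly q))"
        using v2 by (simp add: eq_neg_iff_add_eq_0 add.commute)
      then show ?thesis using \<open>v r \<noteq> 0\<close>
        by (simp add: w_def sum_negf field_simps flip: sum_divide_distrib)
    qed
    \<comment> \<open>The coefficients \<open>w\<close> come from a dependence that involves
      \<open>q\<close>, but the columns \<open>g l\<close> alone determine them.\<close>
    have "(\<Sum>l<r. B (poly p) (poly (g l)) * G l i) = w i" if "i < r" for i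
    proof -
      have "(\<Sum>l<r. B (poly p) (poly (g l)) * G l i) =
          (\<Sum>l<r. \<Sum>k<r. w k * (B (poly (f k)) (poly (g l)) * G l i))"
        using w1 by (intro sum.cong) (auto simp: sum_distrib_right mult.assoc)
      also have "\<dots> = (\<Sum>k<r. w k * (\<Sum>l<r. B (poly (f k)) (poly (g l)) * G l i))"
        by (subst sum.swap) (simp add: sum_distrib_left)
      also have "\<dots> = (\<Sum>k<r. w k * (if k = i then 1 else 0))"
        using G that by (intro sum.cong) auto
      also have "\<dots> = w i" using that by (simp add: if_distrib[of "\<lambda>x. _ * x"] sum.delta cong: if_cong)
      finally show ?thesis .
    qed
    then show "B (poly p) (poly q) =
        (\<Sum>i<r. (\<Sum>l<r. B (poly p) (poly (g l)) * G l i) * B (poly (f i)) (poly q))"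
      using w2 by simp
  qed
qed

text \<open>The form is linear in the first slot and conjugate linear in the second, so the power
  series of the exponentials carry the factorisation over from polynomials, first on the left and
  then on the right.\<close>

lemma B_twist_factor:
  assumes factor: "\<And>p q. B (poly p) (poly q) =
      (\<Sum>i<r. (\<Sum>l<r. B (poly p) (poly (g l)) * G l i) * B (poly (f i)) (poly q))"
  shows "B (twist p a) (twist q b) =
      (\<Sum>i<r. (\<Sum>l<r. B (twist p a) (poly (g l)) * G l i) * B (poly (f i)) (twist q b))"
proof -
  \<comment> \<open>Each term of the exponential series involves a polynomial again, to which
    \<open>factor\<close> applies.\<close>
  have pm: "(\<lambda>w. poly p w * w ^ n) = poly (p * monom 1 n)" for p :: "complex poly" and n
    by (auto simp: poly_monom)
  have left: "B (twist p a) (poly q) =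
      (\<Sum>i<r. (\<Sum>l<r. B (twist p a) (poly (g l)) * G l i) * B (poly (f i)) (poly q))" for q
  proof -
    have s: "(\<lambda>n. a ^ n / fact n * B (poly (p * monom 1 n)) (poly q)) sums B (twist p a) (poly q)" for q
      using B_sums_left[of "poly p" "poly q" a] unfolding pm by (simp add: continuous_intros)
    have "(\<lambda>n. \<Sum>i<r. (\<Sum>l<r. (a ^ n / fact n * B (poly (p * monom 1 n)) (poly (g l))) * G l i) *
         B (poly (f i)) (poly q)) sums
      (\<Sum>i<r. (\<Sum>l<r. B (twist p a) (poly (g l)) * G l i) * B (poly (f i)) (poly q))"
      by (intro sums_sum sums_mult2 s)
    moreover have "(\<lambda>n. \<Sum>i<r. (\<Sum>l<r. (a ^ n / fact n * B (poly (p * monom 1 n)) (poly (g l))) * G l i) *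
         B (poly (f i)) (poly q)) = (\<lambda>n. a ^ n / fact n * B (poly (p * monom 1 n)) (poly q))"
      by (subst factor) (simp add: sum_distrib_left sum_distrib_right mult.assoc)
    ultimately show ?thesis using sums_unique2[OF s[of q]] by simp
  qed
  have s: "(\<lambda>n. cnj b ^ n / fact n * B \<phi> (poly (q * monom 1 n))) sums B \<phi> (twist q b)"
    if "continuous_on UNIV \<phi>" for \<phi>
    using B_sums_right[of \<phi> "poly q" b] that unfolding pm by (simp add: continuous_intros)
  have "(\<lambda>n. \<Sum>i<r. (\<Sum>l<r. B (twist p a) (poly (g l)) * G l i) *
       (cnj b ^ n / fact n * B (poly (f i)) (poly (q * monom 1 n)))) sums
    (\<Sum>i<r. (\<Sum>l<r. B (twist p a) (poly (g l)) * G l i) * B (poly (f i)) (twist q b))"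
    by (intro sums_sum sums_mult s continuous_intros)
  moreover have "(\<lambda>n. \<Sum>i<r. (\<Sum>l<r. B (twist p a) (poly (g l)) * G l i) *
       (cnj b ^ n / fact n * B (poly (f i)) (poly (q * monom 1 n)))) =
     (\<lambda>n. cnj b ^ n / fact n * B (twist p a) (poly (q * monom 1 n)))"
    by (subst (2) left) (simp add: sum_distrib_left mult_ac)
  moreover have "(\<lambda>n. cnj b ^ n / fact n * B (twist p a) (poly (q * monom 1 n))) sums B (twist p a) (twist q b)"
    by (intro s continuous_intros)
  ultimately show ?thesis by (auto intro: sums_unique2)
qed

text \<open>A dependence among the powers of \<open>z\<close> up to \<open>m\<close> gives
  \<open>q\<close> in the left kernel of the form on polynomials; Liouville's theorem transports
  this from \<open>a = 0\<close> to all twists.\<close>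

lemma annihilating_polynomial:
  "\<exists>q. q \<noteq> 0 \<and> degree q \<le> m \<and> (\<forall>a. B (twist q a) (\<lambda>w. exp (- a * w)) = 0)"
proof -
  obtain r f g G where det: "sq_det r (\<lambda>i j. B (poly (f i)) (poly (g j))) \<noteq> 0"
    and G: "sq_det r G \<noteq> 0"
    and factor: "\<And>p q. B (poly p) (poly q) =
      (\<Sum>i<r. (\<Sum>l<r. B (poly p) (poly (g l)) * G l i) * B (poly (f i)) (poly q))"
    by (rule full_rank_minor) (rule that, assumption+)
  define P where "P \<phi> a = (\<lambda>i l. B (twist (\<phi> i) a) (poly (g l)))" for \<phi> :: "nat \<Rightarrow> complex poly" and a
  define Q where "Q a = (\<lambda>k j. B (poly (f k)) (twist (g j) (-a)))" for a
  define E where "E \<phi> a = sq_det r (P \<phi> a) * cnj (sq_det r (Q a))" for \<phi> a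
  \<comment> \<open>\<open>E \<phi>\<close> is entire and \<open>\<bar>E \<phi> a\<bar>\<close> is the modulus of a constant multiple of the determinant of the moments
    twisted by the unimodular function \<open>exp (a z) * cnj (exp (- a z))\<close>, hence bounded in \<open>a\<close>.\<close>
  have E_const: "E \<phi> a = E \<phi> 0" for \<phi> a
  proof -
    have "E \<phi> holomorphic_on UNIV"
      unfolding E_def[abs_def] cnj_sq_det P_def Q_def
      by (intro holomorphic_intros holomorphic_sq_det holomorphic_B_left holomorphic_B_right)
    moreover have "bounded (range (E \<phi>))"
    proof -
      have "sq_det r (P \<phi> a) * sq_det r G * sq_det r (Q a) =
          sq_det r (\<lambda>i j. B (twist (\<phi> i) a) (twist (g j) (-a)))" for a
        unfolding B_twist_factor[OF factor] P_def[symmetric] sq_det_mult[symmetric] Q_def[symmetric]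
        by (simp add: P_def Q_def)
      moreover obtain C where "\<And>a. norm (sq_det r (\<lambda>i j. B (twist (\<phi> i) a) (twist (g j) (-a)))) \<le> C"
        using bounded_sq_det[of "\<lambda>a i j. B (twist (\<phi> i) a) (twist (g j) (-a))" r] bounded_B_twist by blast
      ultimately have "norm (sq_det r (P \<phi> a) * sq_det r G * sq_det r (Q a)) \<le> C" for a by metis
      then have "norm (E \<phi> a) \<le> C / norm (sq_det r G)" for a
        using G by (simp add: E_def norm_mult field_simps)
      then show ?thesis unfolding bounded_iff by blast
    qed
    ultimately have "E \<phi> constant_on UNIV" by (rule Liouville_theorem)
    then obtain c where "\<forall>a. E \<phi> a = c" unfolding constant_on_def by auto
    then show ?thesis by simp
  qed
  \<comment> \<open>At \<open>a = 0\<close> both factors of \<open>E f\<close> come from the chosen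
    minor; a nonzero constant product then keeps either factor from vanishing at any
    \<open>a\<close>.\<close>
  have "E f 0 \<noteq> 0" using det by (simp add: E_def P_def Q_def)
  then have nz: "sq_det r (P f a) \<noteq> 0" "sq_det r (Q a) \<noteq> 0" for a
    using E_const[of f a] by (auto simp: E_def)
  obtain c where c: "\<exists>i\<le>m. c i \<noteq> 0" "\<And>p. (\<Sum>i\<le>m. c i * B (poly (monom 1 i)) (poly p)) = 0"
    using rank[of "monom 1"] unfolding B_def by blast
  define q where "q = (\<Sum>i\<le>m. monom (c i) i)"
  have coeff_q: "coeff q i = c i" if "i \<le> m" for i
    using that by (simp add: q_def coeff_sum sum.delta)
  have "q \<noteq> 0" using c(1) coeff_q by auto
  have "degree q \<le> m" unfolding q_def by (rule degree_sum_le) (auto intro: order_trans[OF degree_monom_le])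
  have q0: "B (poly q) (poly p) = 0" for p
  proof -
    have "B (poly q) (poly p) = (LINT x|M. (\<Sum>i\<le>m. c i * (poly (monom 1 i) (z x) * cnj (poly p (z x)) * h x)))"
      unfolding B_def q_def
      by (intro Bochner_Integration.integral_cong)
         (auto simp: poly_sum poly_monom sum_distrib_left sum_distrib_right mult_ac intro!: sum.cong)
    also have "\<dots> = (\<Sum>i\<le>m. c i * B (poly (monom 1 i)) (poly p))"
      unfolding B_def
      by (subst Bochner_Integration.integral_sum)
         (auto intro!: integrable_mult_right integrable_B[of "\<lambda>w. poly (monom 1 _) w * cnj (poly p w)"] continuous_intros)
    finally show ?thesis using c(2) by simp
  qed
  \<comment> \<open>Cramer's rule: with \<open>q\<close> in place of \<open>f k\<close>, row
    \<open>k\<close> vanishes at \<open>a = 0\<close>, hence so does \<open>E\<close> at every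
    \<open>a\<close>; as the factor from \<open>Q a\<close> is nonzero, the other determinant
    vanishes.\<close>
  have "B (twist q a) (poly (g l)) = 0" if "l < r" for a l
  proof (rule sq_det_replace_rows_zero[OF nz(1) _ that])
    fix k assume k: "k < r"
    have "E (f(k := q)) 0 = 0"
      unfolding E_def by (simp add: sq_det_row_zero[OF k] P_def q0)
    then have "E (f(k := q)) a = 0"
      using E_const[of "f(k := q)" a] by simp
    then have "sq_det r (P (f(k := q)) a) = 0"
      using nz(2)[of a] by (simp add: E_def)
    moreover have "P (f(k := q)) a = (P f a)(k := \<lambda>l. B (twist q a) (poly (g l)))"
      by (auto simp: P_def fun_eq_iff)
    ultimately show "sq_det r ((P f a)(k := \<lambda>l. B (twist q a) (poly (g l)))) = 0" by simp
  qed
  \<comment> \<open>All coefficients of the factorisation vanish, so the right slot is free to be a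
    pure exponential.\<close>
  then have "B (twist q a) (twist 1 (-a)) = 0" for a
    unfolding B_twist_factor[OF factor] by simp
  then show ?thesis using \<open>q \<noteq> 0\<close> \<open>degree q \<le> m\<close> by auto
qed

end

subsection \<open>Vanishing Fourier transforms\<close>

text \<open>Real trigonometric polynomials: the phase \<open>t\<close> covers sines, and
  \<open>w = 0\<close> gives the constants.\<close>

inductive trig_fun :: "('e::euclidean_space \<Rightarrow> real) \<Rightarrow> bool" where
  cos: "trig_fun (\<lambda>x. c * cos (w \<bullet> x + t))"
| add: "trig_fun f \<Longrightarrow> trig_fun g \<Longrightarrow> trig_fun (\<lambda>x. f x + g x)"

lemma trig_fun_mult:
  assumes "trig_fun f" "trig_fun g"
  shows "trig_fun (\<lambda>x. f x * g x)"
  using assms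
proof (induction arbitrary: g rule: trig_fun.induct)
  case (cos c w t)
  from cos show ?case
  proof (induction rule: trig_fun.induct)
    case (cos d v s)
    have "(\<lambda>x. c * cos (w \<bullet> x + t) * (d * cos (v \<bullet> x + s))) =
      (\<lambda>x. c * d / 2 * cos ((w - v) \<bullet> x + (t - s)) + c * d / 2 * cos ((w + v) \<bullet> x + (t + s)))"
    proof
      fix x
      have "cos (w \<bullet> x + t) * cos (v \<bullet> x + s) =
          (cos ((w - v) \<bullet> x + (t - s)) + cos ((w + v) \<bullet> x + (t + s))) / 2"
      proof -
        have "(w - v) \<bullet> x + (t - s) = (w \<bullet> x + t) - (v \<bullet> x + s)"
          "(w + v) \<bullet> x + (t + s) = (w \<bullet> x + t) + (v \<bullet> x + s)"
          by (simp_all add: inner_diff_left inner_add_left)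
        then show ?thesis by (simp only: cos_times_cos)
      qed
      then show "c * cos (w \<bullet> x + t) * (d * cos (v \<bullet> x + s)) =
        c * d / 2 * cos ((w - v) \<bullet> x + (t - s)) + c * d / 2 * cos ((w + v) \<bullet> x + (t + s))"
        by (simp add: field_simps)
    qed
    then show ?case by (simp only:) (intro trig_fun.intros)
  next
    case (add f g)
    then show ?case using trig_fun.add[OF add.IH] by (simp add: distrib_left)
  qed
next
  case (add f f')
  then show ?case using trig_fun.add[OF add.IH[OF add.prems]] by (simp add: distrib_right)
qed

lemma continuous_on_trig_fun: "trig_fun f \<Longrightarrow> continuous_on S f"
  by (induction rule: trig_fun.induct) (auto intro!: continuous_intros)

lemma trig_fun_dense:
  fixes g :: "'e::euclidean_space \<Rightarrow> real"
  assumes "compact S" "continuous_on S g" "e > 0"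
  shows "\<exists>f. trig_fun f \<and> (\<forall>x\<in>S. \<bar>g x - f x\<bar> < e)"
proof (rule Stone_Weierstrass_HOL[where P = trig_fun, OF assms(1) _ _ _ _ _ assms(2,3)])
  show "trig_fun (\<lambda>x. c)" for c using trig_fun.cos[of c 0 0] by simp
  fix x y :: 'e assume "x \<in> S \<and> y \<in> S \<and> x \<noteq> y"
  \<comment> \<open>The frequency is scaled so that
    \<open>cos (w \<bullet> _ - w \<bullet> y)\<close> is 0 at \<open>x\<close> and 1 at
    \<open>y\<close>.\<close>
  define w where "w = (pi / 2 / ((x - y) \<bullet> (x - y))) *\<^sub>R (x - y)"
  have "w \<bullet> x - w \<bullet> y = pi / 2"
    using \<open>x \<in> S \<and> y \<in> S \<and> x \<noteq> y\<close> unfolding inner_diff_right[symmetric] by (simp add: w_def)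
  then have "w \<bullet> x + - (w \<bullet> y) = pi / 2" by simp
  then have "cos (w \<bullet> x + - (w \<bullet> y)) = 0" by (simp only: cos_pi_half)
  then show "\<exists>f. trig_fun f \<and> f x \<noteq> f y"
    using trig_fun.cos[of 1 w "- (w \<bullet> y)"] by (intro exI conjI) auto
qed (auto intro: continuous_on_trig_fun trig_fun.add trig_fun_mult)

text \<open>The image under \<open>T\<close> of the complex measure with density \<open>k\<close> is
  carried by a ball and has Fourier transform zero; the aim is that this image measure
  vanishes.\<close>

locale vanishing_transform =
  fixes M :: "'a measure" and k :: "'a \<Rightarrow> complex" and T :: "'a \<Rightarrow> 'e::euclidean_space" and R :: real
  assumes k: "integrable M k" and T: "T \<in> borel_measurable M"
    and R: "\<And>x. x \<in> space M \<Longrightarrow> k x \<noteq> 0 \<Longrightarrow> norm (T x) \<le> R"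
    and vanish: "\<And>w. (LINT x|M. cis (w \<bullet> T x) * k x) = 0"
begin

lemma integral_trig_fun: "trig_fun f \<Longrightarrow> (LINT x|M. of_real (f (T x)) * k x) = 0"
proof (induction rule: trig_fun.induct)
  case (cos c w t)
  have int: "integrable M (\<lambda>x. cis (v \<bullet> T x) * k x)" for v
    by (rule integrable_comp_mult[OF k T R]) (auto intro!: continuous_intros simp: cis_conv_exp)
  have "of_real (c * cos (w \<bullet> T x + t)) * k x =
      (of_real c * cis t / 2) * (cis (w \<bullet> T x) * k x) + (of_real c * cis (-t) / 2) * (cis ((-w) \<bullet> T x) * k x)" for x
  proof -
    have "of_real (cos a) = (cis a + cis (-a)) / 2" for a
      by (simp add: complex_eq_iff)
    moreover have "cis (w \<bullet> T x + t) = cis t * cis (w \<bullet> T x)"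
      "cis (- (w \<bullet> T x + t)) = cis (-t) * cis ((-w) \<bullet> T x)"
      by (simp_all add: cis_mult add.commute del: cis_inverse)
    ultimately show ?thesis by (simp only: of_real_mult) (simp add: field_simps)
  qed
  then show ?case using vanish int
    by (simp add: Bochner_Integration.integral_add del: inner_minus_left cis_inverse)
next
  case (add f g)
  have "integrable M (\<lambda>x. of_real (f (T x)) * k x)" if "trig_fun f" for f
    by (rule integrable_comp_mult[OF k T R])
       (auto intro!: continuous_intros continuous_on_trig_fun that)
  then show ?case using add by (simp add: distrib_right)
qed

text \<open>On the ball of radius \<open>R\<close>, \<open>g\<close> is uniformly within any
  \<open>e\<close> of a trigonometric polynomial, whose integral is zero.\<close>

lemma integral_real_continuous:
  assumes g: "continuous_on UNIV (g :: 'e \<Rightarrow> real)"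
  shows "(LINT x|M. of_real (g (T x)) * k x) = 0"
proof -
  have int: "integrable M (\<lambda>x. of_real (g (T x)) * k x)" if "continuous_on UNIV g" for g :: "'e \<Rightarrow> real"
    by (rule integrable_comp_mult[OF k T R]) (auto intro!: continuous_intros that)
  define I where "I = (LINT x|M. norm (k x))"
  have "norm (LINT x|M. of_real (g (T x)) * k x) \<le> e * I" if "e > 0" for e
  proof -
    obtain f where f: "trig_fun f" "\<And>y. y \<in> cball 0 R \<Longrightarrow> \<bar>g y - f y\<bar> < e"
      using trig_fun_dense[OF compact_cball continuous_on_subset[OF g] \<open>e > 0\<close>, of 0 R] by auto
    have "(LINT x|M. of_real (g (T x)) * k x) =
        (LINT x|M. of_real (g (T x)) * k x) - (LINT x|M. of_real (f (T x)) * k x)"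
      using integral_trig_fun[OF f(1)] by simp
    also have "\<dots> = (LINT x|M. of_real (g (T x)) * k x - of_real (f (T x)) * k x)"
      by (intro Bochner_Integration.integral_diff[symmetric] int g continuous_on_trig_fun f)
    also have "norm \<dots> \<le> (LINT x|M. e * norm (k x))"
    proof (rule order_trans[OF integral_norm_bound integral_mono])
      show "integrable M (\<lambda>x. norm (of_real (g (T x)) * k x - of_real (f (T x)) * k x))"
        by (intro integrable_norm Bochner_Integration.integrable_diff int g continuous_on_trig_fun f)
      fix x assume x: "x \<in> space M"
      show "norm (of_real (g (T x)) * k x - of_real (f (T x)) * k x) \<le> e * norm (k x)"
      proof (cases "k x = 0")
        case False
        then have "\<bar>g (T x) - f (T x)\<bar> \<le> e" using f(2)[of "T x"] R[OF x] by simp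
        then have "norm (of_real (g (T x) - f (T x)) * k x) \<le> e * norm (k x)"
          unfolding norm_mult by (intro mult_right_mono) (auto simp flip: of_real_diff)
        then show ?thesis by (simp add: algebra_simps)
      qed simp
    qed (use k in auto)
    finally show ?thesis by (simp add: I_def)
  qed
  then have "eventually (\<lambda>e. norm (LINT x|M. of_real (g (T x)) * k x) \<le> e * I) (at_right 0)"
    by (intro eventually_mono[OF eventually_at_right_less[of "0::real"]])
  moreover have "((\<lambda>e. e * I) \<longlongrightarrow> 0 * I) (at_right 0)"
    by (intro tendsto_intros)
  ultimately have "norm (LINT x|M. of_real (g (T x)) * k x) \<le> 0 * I"
    using tendsto_lowerbound trivial_limit_at_right_real by blast
  then show ?thesis by simp
qed

lemma integral_continuous:
  assumes G: "continuous_on UNIV (G :: 'e \<Rightarrow> complex)"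
  shows "(LINT x|M. G (T x) * k x) = 0"
proof -
  have "(LINT x|M. G (T x) * k x) =
      (LINT x|M. of_real (Re (G (T x))) * k x + \<i> * (of_real (Im (G (T x))) * k x))"
    by (intro Bochner_Integration.integral_cong) (auto simp: complex_eq_iff algebra_simps)
  also have "\<dots> = (LINT x|M. of_real (Re (G (T x))) * k x) + \<i> * (LINT x|M. of_real (Im (G (T x))) * k x)"
    by (subst Bochner_Integration.integral_add)
       (auto intro!: integrable_mult_right integrable_comp_mult[OF k T R] continuous_intros G)
  also have "\<dots> = 0"
    using integral_real_continuous[of "\<lambda>y. Re (G y)"] integral_real_continuous[of "\<lambda>y. Im (G y)"] G
    by (simp add: continuous_intros)
  finally show ?thesis .
qed

text \<open>The sets with vanishing integral form a Dynkin system, so it suffices to treat closed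
  sets, which are stable under intersection and generate the Borel sets.\<close>

lemma integral_borel:
  assumes "A \<in> sets borel"
  shows "(LINT x:(T -` A \<inter> space M)|M. k x) = 0"
proof -
  have [measurable]: "k \<in> borel_measurable M" "T \<in> borel_measurable M" using k T by auto
  have int: "set_integrable M B k" if "B \<in> sets M" for B
    unfolding set_integrable_def using k that by (rule integrable_mult_indicator[rotated])
  have all: "(LINT x|M. k x) = 0" using integral_continuous[of "\<lambda>_. 1"] by simp
  have "Int_stable (Collect closed :: 'e set set)" by (auto simp: Int_stable_def)
  moreover have "Collect closed \<subseteq> Pow (UNIV :: 'e set)" by simp
  moreover have "A \<in> sigma_sets UNIV (Collect closed)"
    using assms unfolding borel_eq_closed by (simp add: sets_measure_of)
  ultimately show ?thesis
  proof (induction rule: sigma_sets_induct_disjoint)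
    case (basic C)
    then have "closed C" by simp
    show ?case
    proof (cases "C = {}")
      case False
      \<comment> \<open>Continuous cut-offs decreasing to the indicator of \<open>C\<close>. The
        empty set is treated apart because \<open>infdist\<close> to it is 0 by convention.\<close>
      define g where "g n y = max 0 (1 - real n * infdist y C)" for n y
      have "(\<lambda>n. LINT x|M. of_real (g n (T x)) * k x) \<longlonglongrightarrow> (LINT x|M. indicat_real (T -` C \<inter> space M) x *\<^sub>R k x)"
      proof (rule integral_dominated_convergence[where w = "\<lambda>x. norm (k x)"])
        show "AE x in M. (\<lambda>n. of_real (g n (T x)) * k x) \<longlonglongrightarrow> indicat_real (T -` C \<inter> space M) x *\<^sub>R k x"
        proof (rule AE_I2)
          fix x assume x: "x \<in> space M"
          have "(\<lambda>n. g n (T x)) \<longlonglongrightarrow> indicat_real (T -` C \<inter> space M) x"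
          proof (cases "T x \<in> C")
            case True
            then show ?thesis using x by (simp add: g_def)
          next
            case out: False
            then have pos: "infdist (T x) C > 0"
              using \<open>closed C\<close> \<open>C \<noteq> {}\<close> by (simp add: infdist_pos_not_in_closed)
            obtain n0 where n0: "1 < real n0 * infdist (T x) C"
              using reals_Archimedean3[OF pos] by blast
            have "g n (T x) = 0" if "n \<ge> n0" for n
            proof -
              have "real n0 * infdist (T x) C \<le> real n * infdist (T x) C"
                using that pos by (intro mult_right_mono) auto
              then show ?thesis using n0 by (simp add: g_def)
            qed
            then have "eventually (\<lambda>n. g n (T x) = 0) sequentially"
              unfolding eventually_sequentially by blast
            then show ?thesis using out by (simp add: tendsto_eventually)
          qed
          then show "(\<lambda>n. of_real (g n (T x)) * k x) \<longlonglongrightarrow> indicat_real (T -` C \<inter> space M) x *\<^sub>R k x"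
            unfolding scaleR_conv_of_real by (intro tendsto_intros)
        qed
        show "AE x in M. norm (of_real (g n (T x)) * k x) \<le> norm (k x)" for n
          by (auto simp: g_def norm_mult infdist_nonneg intro!: mult_left_le_one_le)
        have [measurable]: "g n \<in> borel_measurable borel" for n
          by (auto simp: g_def intro!: borel_measurable_continuous_onI continuous_intros)
        show "(\<lambda>x. of_real (g n (T x)) * k x) \<in> borel_measurable M" for n by measurable
        show "(\<lambda>x. indicat_real (T -` C \<inter> space M) x *\<^sub>R k x) \<in> borel_measurable M"
          using \<open>closed C\<close> by (intro borel_measurable_scaleR borel_measurable_indicator measurable_sets[OF T]) auto
      qed (use k in auto)
      moreover have "(LINT x|M. of_real (g n (T x)) * k x) = 0" for n
        by (rule integral_real_continuous) (auto simp: g_def intro!: continuous_intros)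
      ultimately show ?thesis
        unfolding set_lebesgue_integral_def by (simp add: LIMSEQ_const_iff)
    qed (simp add: set_lebesgue_integral_def)
  next
    case empty
    show ?case by (simp add: set_lebesgue_integral_def)
  next
    case (compl A)
    then have A: "A \<in> sets borel" unfolding borel_eq_closed by (simp add: sets_measure_of)
    have "(LINT x:(T -` A \<inter> space M) \<union> (T -` (UNIV - A) \<inter> space M)|M. k x) =
       (LINT x:(T -` A \<inter> space M)|M. k x) + (LINT x:(T -` (UNIV - A) \<inter> space M)|M. k x)"
      using A by (intro set_integral_Un int measurable_sets[OF T]) auto
    moreover have "(T -` A \<inter> space M) \<union> (T -` (UNIV - A) \<inter> space M) = space M" by auto
    moreover have "(LINT x:space M|M. k x) = 0"
      using all by (simp add: set_integral_space[OF k])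
    ultimately show ?case using compl by simp
  next
    case (union A)
    then have A: "A i \<in> sets borel" for i unfolding borel_eq_closed by (auto simp: sets_measure_of)
    have "(LINT x:(\<Union>i. T -` A i \<inter> space M)|M. k x) = (\<Sum>i. LINT x:(T -` A i \<inter> space M)|M. k x)"
    proof (rule lebesgue_integral_countable_add)
      show "set_integrable M (\<Union>i. T -` A i \<inter> space M) k"
        using A by (intro int sets.countable_UN) (auto intro!: measurable_sets[OF T])
      show "(T -` A i \<inter> space M) \<inter> (T -` A j \<inter> space M) = {}" if "i \<noteq> j" for i j
        using union(1) that by (auto simp: disjoint_family_on_def)
    qed (use A measurable_sets[OF T] in auto)
    moreover have "T -` (\<Union>i. A i) \<inter> space M = (\<Union>i. T -` A i \<inter> space M)" by auto
    ultimately show ?case using union by simp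
  qed
qed

end

subsection \<open>Generic projections\<close>

text \<open>For fixed \<open>x \<noteq> y\<close> the bad \<open>\<xi>\<close> fill a hyperplane,
  which is a null set; Fubini then exchanges the quantifiers.\<close>

lemma AE_generic_direction:
  fixes M :: "'e::euclidean_space measure"
  assumes "finite_measure M" and sets: "sets M = sets borel"
  shows "AE \<xi> in lborel. AE x in M. AE y in M. x \<noteq> y \<longrightarrow> \<xi> \<bullet> x \<noteq> \<xi> \<bullet> y"
proof -
  interpret M: finite_measure M by fact
  interpret MM: pair_sigma_finite M M ..
  interpret MM': sigma_finite_measure "M \<Otimes>\<^sub>M M" by (rule MM.sigma_finite_measure_axioms)
  interpret L: pair_sigma_finite lborel "M \<Otimes>\<^sub>M M" ..
  note [measurable_cong] = sets
  have meas: "{q \<in> space (lborel \<Otimes>\<^sub>M (M \<Otimes>\<^sub>M M)). fst (snd q) \<noteq> snd (snd q) \<longrightarrow> fst q \<bullet> fst (snd q) \<noteq> fst q \<bullet> snd (snd q)}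
      \<in> sets ((lborel :: 'e measure) \<Otimes>\<^sub>M (M \<Otimes>\<^sub>M M))"
    by measurable
  have "AE \<xi> in lborel. x \<noteq> y \<longrightarrow> \<xi> \<bullet> x \<noteq> \<xi> \<bullet> y" for x y :: 'e
  proof (cases "x = y")
    case False
    let ?H = "{\<xi>. (x - y) \<bullet> \<xi> = 0}"
    have "?H \<in> null_sets lebesgue"
      using negligible_hyperplane[of "x - y" 0] False by (simp add: negligible_iff_null_sets)
    moreover have "?H \<in> sets lborel" by (simp add: closed_hyperplane borel_closed)
    ultimately have "?H \<in> null_sets lborel" using null_sets_completion_iff by blast
    then have "AE \<xi> in lborel. \<xi> \<notin> ?H" by (rule AE_not_in)
    then show ?thesis by eventually_elim (auto simp: inner_diff_left inner_commute[of "_ - _"] inner_diff_right inner_commute)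
  qed simp
  then have "AE p in M \<Otimes>\<^sub>M M. AE \<xi> in lborel. fst p \<noteq> snd p \<longrightarrow> \<xi> \<bullet> fst p \<noteq> \<xi> \<bullet> snd p"
    by simp
  then have "AE \<xi> in lborel. AE p in M \<Otimes>\<^sub>M M. fst p \<noteq> snd p \<longrightarrow> \<xi> \<bullet> fst p \<noteq> \<xi> \<bullet> snd p"
    using L.AE_commute[OF meas] by blast
  then show ?thesis
    by eventually_elim (auto dest: MM.AE_pair)
qed

text \<open>Almost every \<open>x\<close>, if it lies in \<open>H\<close>, has almost no other point
  of \<open>H\<close> beside it, so it can serve as \<open>b\<close>.\<close>

lemma generic_concentration:
  fixes M :: "'e::euclidean_space measure"
  assumes "AE x in M. AE y in M. x \<noteq> y \<longrightarrow> \<xi> \<bullet> x \<noteq> \<xi> \<bullet> y"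
    and H: "\<And>x y. x \<in> H \<Longrightarrow> y \<in> H \<Longrightarrow> \<xi> \<bullet> x = \<xi> \<bullet> y"
  shows "(AE x in M. x \<notin> H) \<or> (\<exists>b\<in>H. AE y in M. y \<in> H \<longrightarrow> y = b)"
proof (rule disjCI)
  assume no: "\<not> (\<exists>b\<in>H. AE y in M. y \<in> H \<longrightarrow> y = b)"
  show "AE x in M. x \<notin> H"
    using assms(1)
  proof eventually_elim
    case (elim x)
    have "AE y in M. y \<in> H \<longrightarrow> y = x" if "x \<in> H"
      using elim by eventually_elim (use H that in blast)
    then show ?case using no by blast
  qed
qed

section \<open>From annihilating polynomials to finite support\<close>

text \<open>The unimodular twists run through all characters of the plane, so \<open>q\<close> times
  the density has transform zero. The factor \<open>q\<close> is then divided out away from its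
  zeros.\<close>

lemma (in finite_rank_moments) vanishing_transform_off_zeros:
  "\<exists>q. q \<noteq> 0 \<and> degree q \<le> m \<and>
    vanishing_transform M (\<lambda>x. if poly q (z x) = 0 then 0 else h x) z R"
proof -
  obtain q where q: "q \<noteq> 0" "degree q \<le> m" and Bq: "\<And>a. B (twist q a) (\<lambda>w. exp (- a * w)) = 0"
    using annihilating_polynomial by blast
  have [measurable]: "h \<in> borel_measurable M" "z \<in> borel_measurable M" using h z by auto
  have [measurable]: "poly q \<in> borel_measurable borel"
    by (intro borel_measurable_continuous_onI continuous_intros)
  have "(LINT x|M. cis (w \<bullet> z x) * (poly q (z x) * h x)) = 0" for w
  proof -
    \<comment> \<open>Chosen so that \<open>2 * Im (?a * y) = w \<bullet> y\<close>.\<close>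
    let ?a = "Complex (Im w / 2) (Re w / 2)"
    have "exp (?a * y) * cnj (exp (- ?a * y)) = cis (w \<bullet> y)" for y
    proof -
      have "?a * y + cnj (- ?a * y) = \<i> * of_real (w \<bullet> y)"
        by (simp add: complex_eq_iff inner_complex_def algebra_simps)
      then show ?thesis by (simp only: exp_cnj exp_add[symmetric] cis_conv_exp)
    qed
    then have "(\<lambda>x. poly q (z x) * exp (?a * z x) * cnj (exp (- ?a * z x)) * h x) =
        (\<lambda>x. cis (w \<bullet> z x) * (poly q (z x) * h x))"
      by (metis mult.assoc mult.commute)
    then show ?thesis using Bq[of ?a] unfolding B_def by (simp only:)
  qed
  then interpret qh: vanishing_transform M "\<lambda>x. poly q (z x) * h x" z R
    by unfold_locales (auto intro!: integrable_B[of "poly q"] continuous_intros z R)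
  have "(LINT x|M. cis (w \<bullet> z x) * (if poly q (z x) = 0 then 0 else h x)) = 0" for w
  proof -
    \<comment> \<open>\<open>g n\<close> is a continuous regularisation of \<open>cis (w \<bullet> y) / poly q y\<close>, so that \<open>g n * q\<close> tends to
      \<open>cis (w \<bullet> y)\<close> off the zeros of \<open>q\<close>.\<close>
    define g where "g n y = cis (w \<bullet> y) * cnj (poly q y) / of_real ((norm (poly q y))\<^sup>2 + 1 / Suc n)"
      for n and y :: complex
    have pos: "(norm (poly q y))\<^sup>2 + 1 / Suc n > 0" for n y
      by (intro add_nonneg_pos) auto
    have pos': "complex_of_real ((norm (poly q y))\<^sup>2 + 1 / Suc n) \<noteq> 0" for n y
      using pos[of y n] unfolding of_real_eq_0_iff by linarith
    have cont: "continuous_on UNIV (g n)" for n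
      unfolding g_def cis_conv_exp by (intro continuous_intros ballI pos')
    have gq: "g n y * poly q y = cis (w \<bullet> y) * of_real ((norm (poly q y))\<^sup>2 / ((norm (poly q y))\<^sup>2 + 1 / Suc n))" for n y
      using complex_norm_square[of "poly q y"] unfolding g_def by (simp add: mult_ac)
    have "(\<lambda>n. LINT x|M. g n (z x) * (poly q (z x) * h x)) \<longlonglongrightarrow>
        (LINT x|M. cis (w \<bullet> z x) * (if poly q (z x) = 0 then 0 else h x))"
    proof (rule integral_dominated_convergence[where w = "\<lambda>x. norm (h x)"])
      have [measurable]: "g n \<in> borel_measurable borel" for n
        using cont by (rule borel_measurable_continuous_onI)
      have [measurable]: "cis \<in> borel_measurable borel"
        unfolding cis_conv_exp[abs_def] by (intro borel_measurable_continuous_onI continuous_intros)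
      show "(\<lambda>x. g n (z x) * (poly q (z x) * h x)) \<in> borel_measurable M" for n by measurable
      show "(\<lambda>x. cis (w \<bullet> z x) * (if poly q (z x) = 0 then 0 else h x)) \<in> borel_measurable M"
        by measurable
      show "AE x in M. (\<lambda>n. g n (z x) * (poly q (z x) * h x)) \<longlonglongrightarrow>
          cis (w \<bullet> z x) * (if poly q (z x) = 0 then 0 else h x)"
      proof (rule AE_I2)
        fix x
        have "(\<lambda>n. g n (z x) * poly q (z x)) \<longlonglongrightarrow> cis (w \<bullet> z x) * (if poly q (z x) = 0 then 0 else 1)"
        proof (cases "poly q (z x) = 0")
          case False
          let ?c = "(norm (poly q (z x)))\<^sup>2"
          have "(\<lambda>n. ?c / (?c + 1 / Suc n)) \<longlonglongrightarrow> ?c / (?c + 0)"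
            using False by (intro tendsto_intros LIMSEQ_Suc lim_inverse_n') auto
          then have "(\<lambda>n. of_real (?c / (?c + 1 / Suc n))) \<longlonglongrightarrow> complex_of_real 1"
            using False by (intro tendsto_of_real) simp
          then show ?thesis unfolding gq using False
            by (intro tendsto_mult tendsto_const) simp
        qed simp
        from tendsto_mult[OF this tendsto_const[of "h x"]]
        have "(\<lambda>n. g n (z x) * poly q (z x) * h x) \<longlonglongrightarrow>
            cis (w \<bullet> z x) * (if poly q (z x) = 0 then 0 else 1) * h x" .
        then show "(\<lambda>n. g n (z x) * (poly q (z x) * h x)) \<longlonglongrightarrow>
          cis (w \<bullet> z x) * (if poly q (z x) = 0 then 0 else h x)"
          by (auto simp: mult.assoc split: if_splits)
      qed
      show "AE x in M. norm (g n (z x) * (poly q (z x) * h x)) \<le> norm (h x)" for n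
      proof (rule AE_I2)
        fix x
        have "norm (g n (z x) * poly q (z x)) \<le> 1"
          unfolding gq norm_mult norm_cis norm_of_real using pos[of "z x" n]
          by (simp add: divide_le_eq)
        then show "norm (g n (z x) * (poly q (z x) * h x)) \<le> norm (h x)"
          unfolding mult.assoc[symmetric] norm_mult[of _ "h x"] by (intro mult_left_le_one_le) auto
      qed
    qed (use h in auto)
    then show ?thesis using qh.integral_continuous[OF cont] by (simp add: LIMSEQ_const_iff)
  qed
  moreover have "integrable M (\<lambda>x. if poly q (z x) = 0 then 0 else h x)"
    by (rule Bochner_Integration.integrable_bound[OF h]) auto
  ultimately show ?thesis using q z R
    by (intro exI[of _ q]) (auto simp: vanishing_transform_def split: if_splits)
qed

text \<open>One generic direction already bounds the number of atoms by the degree of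
  \<open>q\<close>. Almost all directions together kill the transform of what remains.\<close>

lemma finitely_supported_if_projections_finite_rank:
  fixes M :: "'e::euclidean_space measure" and h :: "'e \<Rightarrow> complex"
  assumes fin: "finite_measure M" and sets: "sets M = sets borel" and h: "integrable M h"
    and bd: "\<And>x. h x \<noteq> 0 \<Longrightarrow> norm x \<le> r"
    and rank: "\<And>\<xi>. \<xi> \<noteq> 0 \<Longrightarrow> \<exists>\<eta> R. finite_rank_moments M h (\<lambda>x. Complex (\<xi> \<bullet> x) (\<eta> \<bullet> x)) R m"
  shows "\<exists>At. finite At \<and> card At \<le> m \<and>
    (\<forall>A\<in>sets borel. A \<inter> At = {} \<longrightarrow> (LINT x:A|M. h x) = 0)"
proof -
  interpret finite_measure M by fact
  have space: "space M = UNIV" using sets_eq_imp_space_eq[OF sets] by simp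
  have [measurable_cong]: "sets M = sets borel" by (rule sets)
  have [measurable]: "h \<in> borel_measurable M" using h by simp
  \<comment> \<open>The point masses of the complex measure: \<open>b\<close> is charged by
    \<open>M\<close> and the density does not vanish there.\<close>
  define At where "At = {b. emeasure M {b} \<noteq> 0 \<and> h b \<noteq> 0}"
  define h0 where "h0 = (\<lambda>x. if x \<in> At then 0 else h x)"
  have not_AE: "\<not> (AE y in M. y \<noteq> b)" if "emeasure M {b} \<noteq> 0" for b
    using that AE_iff_measurable[of "{b}" M "\<lambda>y. y \<noteq> b"] by (simp add: sets space)
  \<comment> \<open>For generic \<open>\<xi>\<close> the projection separates the atoms and sees no further mass in its fibres: the
    atoms are mapped injectively to zeros of \<open>q\<close>, and removing the fibres over the zeros
    amounts to removing the atoms.\<close>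
  have dir: "finite At \<and> card At \<le> m \<and> (LINT x|M. cis (\<xi> \<bullet> x) * h0 x) = 0"
    if gen: "AE x in M. AE y in M. x \<noteq> y \<longrightarrow> \<xi> \<bullet> x \<noteq> \<xi> \<bullet> y" and "\<xi> \<noteq> 0" for \<xi>
  proof -
    obtain \<eta> R where rk: "finite_rank_moments M h (\<lambda>x. Complex (\<xi> \<bullet> x) (\<eta> \<bullet> x)) R m"
      using rank[OF \<open>\<xi> \<noteq> 0\<close>] by blast
    define z where "z x = Complex (\<xi> \<bullet> x) (\<eta> \<bullet> x)" for x
    have z: "finite_rank_moments M h z R m" using rk unfolding z_def[abs_def] .
    obtain q where q: "q \<noteq> 0" "degree q \<le> m"
      and van: "vanishing_transform M (\<lambda>x. if poly q (z x) = 0 then 0 else h x) z R"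
      using finite_rank_moments.vanishing_transform_off_zeros[OF z] by blast
    interpret van: vanishing_transform M "\<lambda>x. if poly q (z x) = 0 then 0 else h x" z R by (rule van)
    note [measurable] = van.T
    define H where "H c = z -` {c}" for c
    have conc: "(AE x in M. x \<notin> H c) \<or> (\<exists>b\<in>H c. AE y in M. y \<in> H c \<longrightarrow> y = b)" for c
      by (rule generic_concentration[OF gen]) (auto simp: H_def z_def)
    have conc_At: "AE y in M. y \<in> H (z b) \<longrightarrow> y = b" if b: "b \<in> At" for b
    \<comment> \<open>The fibre through an atom is not null, and its point of concentration can only
      be that atom.\<close>
    proof -
      have nz: "\<not> (AE y in M. y \<noteq> b)" using b not_AE by (simp add: At_def)
      have "\<not> (AE x in M. x \<notin> H (z b))"
      proof
        assume "AE x in M. x \<notin> H (z b)"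
        then have "AE x in M. x \<noteq> b" by eventually_elim (auto simp: H_def)
        with nz show False by blast
      qed
      then obtain b' where b': "AE y in M. y \<in> H (z b) \<longrightarrow> y = b'" using conc by blast
      have "b' = b"
      proof (rule ccontr)
        assume "b' \<noteq> b"
        from b' have "AE y in M. y \<noteq> b"
          by eventually_elim (use \<open>b' \<noteq> b\<close> in \<open>auto simp: H_def\<close>)
        with nz show False by blast
      qed
      with b' show ?thesis by simp
    qed
    \<comment> \<open>Otherwise \<open>z b\<close> would carry a nonzero mass, that of the atom
      \<open>b\<close>, under the image measure off the zeros of \<open>q\<close>, which is
      zero.\<close>
    have root: "poly q (z b) = 0" if b: "b \<in> At" for b
    proof (rule ccontr)
      assume nr: "poly q (z b) \<noteq> 0"
      have "0 = (LINT x:(H (z b) \<inter> space M)|M. (if poly q (z x) = 0 then 0 else h x))"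
        unfolding H_def by (rule van.integral_borel[symmetric]) simp
      also have "\<dots> = (LINT x|M. indicator {b} x *\<^sub>R h b)"
        unfolding set_lebesgue_integral_def
      proof (rule integral_cong_AE)
        show "AE x in M. indicat_real (H (z b) \<inter> space M) x *\<^sub>R (if poly q (z x) = 0 then 0 else h x) =
            indicator {b} x *\<^sub>R h b"
          using conc_At[OF b] by eventually_elim (use nr in \<open>auto simp: H_def space indicator_def\<close>)
        have "H (z b) \<in> sets M" using measurable_sets[OF van.T, of "{z b}"] by (simp add: H_def space)
        then show "(\<lambda>x. indicat_real (H (z b) \<inter> space M) x *\<^sub>R (if poly q (z x) = 0 then 0 else h x)) \<in> borel_measurable M"
          using van.k by measurable
      qed measurable
      also have "\<dots> = Sigma_Algebra.measure M {b} *\<^sub>R h b"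
        by (subst integral_scaleR_left) (auto simp: space sets emeasure_eq_measure)
      finally show False using b by (auto simp: At_def emeasure_eq_measure)
    qed
    have "inj_on z At"
    proof (rule inj_onI)
      fix b b' assume *: "b \<in> At" "b' \<in> At" "z b = z b'"
      have "AE y in M. y \<in> H (z b) \<longrightarrow> y = b \<and> y = b'"
        using conc_At[OF *(1)] conc_At[OF *(2)] unfolding *(3) by eventually_elim blast
      then have "AE y in M. b \<noteq> b' \<longrightarrow> y \<noteq> b" by eventually_elim (auto simp: H_def)
      then show "b = b'" using not_AE[of b] *(1) by (cases "b = b'") (auto simp: At_def)
    qed
    moreover have "z ` At \<subseteq> {c. poly q c = 0}" using root by auto
    moreover have fr: "finite {c. poly q c = 0}" using q(1) by (rule poly_roots_finite)
    moreover have "card {c. poly q c = 0} \<le> m"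
      using card_poly_roots_bound[OF q(1)] q(2) by linarith
    ultimately have fin_At: "finite At" and card_At: "card At \<le> m"
      using inj_on_finite card_inj_on_le by (blast, meson order_trans)
    have [measurable]: "At \<in> sets borel" using fin_At by (simp add: finite_imp_closed borel_closed)
    \<comment> \<open>If the fibre is concentrated at \<open>b\<close>, then either
      \<open>{b}\<close> is null, or \<open>b\<close> lies in \<open>At\<close> unless
      \<open>h b = 0\<close>.\<close>
    have "AE x in M. x \<in> H c \<longrightarrow> x \<in> At \<or> h x = 0" for c
      using conc[of c]
    proof
      assume "AE x in M. x \<notin> H c"
      then show ?thesis by eventually_elim auto
    next
      assume "\<exists>b\<in>H c. AE y in M. y \<in> H c \<longrightarrow> y = b"
      then obtain b where b: "b \<in> H c" "AE y in M. y \<in> H c \<longrightarrow> y = b" by blast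
      show ?thesis
      proof (cases "emeasure M {b} = 0")
        case True
        then have "AE y in M. y \<noteq> b"
          using AE_iff_measurable[of "{b}" M "\<lambda>y. y \<noteq> b"] by (simp add: sets space)
        with b(2) show ?thesis by eventually_elim auto
      next
        case False
        from b(2) show ?thesis by eventually_elim (use False in \<open>auto simp: At_def\<close>)
      qed
    qed
    then have "AE x in M. \<forall>c\<in>{c. poly q c = 0}. x \<in> H c \<longrightarrow> x \<in> At \<or> h x = 0"
      by (intro AE_finite_allI fr)
    then have eq: "AE x in M. (if poly q (z x) = 0 then 0 else h x) = h0 x"
      by eventually_elim (use root in \<open>auto simp: H_def h0_def\<close>)
    have [measurable]: "cis \<in> borel_measurable borel"
      unfolding cis_conv_exp[abs_def] by (intro borel_measurable_continuous_onI continuous_intros)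
    \<comment> \<open>Frequency 1 in the plane picks out the real part
      \<open>\<xi> \<bullet> x\<close> of \<open>z x\<close>.\<close>
    have "(LINT x|M. cis (\<xi> \<bullet> x) * h0 x) =
        (LINT x|M. cis (1 \<bullet> z x) * (if poly q (z x) = 0 then 0 else h x))"
    proof (rule integral_cong_AE)
      show "AE x in M. cis (\<xi> \<bullet> x) * h0 x = cis (1 \<bullet> z x) * (if poly q (z x) = 0 then 0 else h x)"
        using eq by eventually_elim (simp add: z_def inner_complex_def)
      show "(\<lambda>x. cis (\<xi> \<bullet> x) * h0 x) \<in> borel_measurable M" unfolding h0_def by measurable
      show "(\<lambda>x. cis (1 \<bullet> z x) * (if poly q (z x) = 0 then 0 else h x)) \<in> borel_measurable M"
        using van.k by measurable
    qed
    also have "\<dots> = 0" by (rule van.vanish)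
    finally show ?thesis using fin_At card_At by blast
  qed
  have "AE \<xi> in lborel. \<xi> \<noteq> (0::'e)"
    using AE_iff_measurable[of "{0::'e}" lborel "\<lambda>\<xi>. \<xi> \<noteq> 0"] by simp
  with AE_generic_direction[OF fin sets]
  have AE: "AE \<xi> in lborel. finite At \<and> card At \<le> m \<and> (LINT x|M. cis (\<xi> \<bullet> x) * h0 x) = 0"
    by eventually_elim (use dir in blast)
  \<comment> \<open>The claim is independent of \<open>\<xi>\<close>, and Lebesgue measure is
    nonzero, so some good \<open>\<xi>\<close> exists.\<close>
  have "finite At \<and> card At \<le> m"
  proof (rule ccontr)
    assume "\<not> (finite At \<and> card At \<le> m)"
    from AE have "AE \<xi> in (lborel :: 'e measure). False"
      by eventually_elim (use \<open>\<not> (finite At \<and> card At \<le> m)\<close> in blast)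
    then show False using ae_filter_eq_bot_iff[of "lborel :: 'e measure"] by (simp add: trivial_limit_def)
  qed
  then have fin_At: "finite At" and card_At: "card At \<le> m" by auto
  have [measurable]: "At \<in> sets borel" using fin_At by (simp add: finite_imp_closed borel_closed)
  have [measurable]: "h0 \<in> borel_measurable M" unfolding h0_def by measurable
  have h0: "integrable M h0"
    by (rule Bochner_Integration.integrable_bound[OF h]) (auto simp: h0_def)
  define F where "F \<xi> = (LINT x|M. cis (\<xi> \<bullet> x) * h0 x)" for \<xi>
  have [measurable]: "cis \<in> borel_measurable borel"
    unfolding cis_conv_exp[abs_def] by (intro borel_measurable_continuous_onI continuous_intros)
  have lim: "(\<lambda>n. F (u n)) \<longlonglongrightarrow> F \<xi>" if "u \<longlonglongrightarrow> \<xi>" for u \<xi>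
    unfolding F_def
  proof (rule integral_dominated_convergence[where w = "\<lambda>x. norm (h0 x)"])
    show "AE x in M. (\<lambda>n. cis (u n \<bullet> x) * h0 x) \<longlonglongrightarrow> cis (\<xi> \<bullet> x) * h0 x"
      unfolding cis_conv_exp by (intro AE_I2 tendsto_intros that)
  qed (use h0 in \<open>auto simp: norm_mult\<close>)
  \<comment> \<open>\<open>F\<close> is continuous, so its nonvanishing set is open; being null as
    well, it is empty.\<close>
  have "F \<xi> = 0" for \<xi>
  proof (rule ccontr)
    assume "F \<xi> \<noteq> 0"
    have "closed {\<xi>. F \<xi> = 0}"
      unfolding closed_sequential_limits
    proof (intro allI impI, elim conjE)
      fix u l assume "\<forall>n. u n \<in> {\<xi>. F \<xi> = 0}" "u \<longlonglongrightarrow> l"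
      then show "l \<in> {\<xi>. F \<xi> = 0}" using lim[of u l] by (simp add: LIMSEQ_const_iff)
    qed
    then have op: "open {\<xi>. F \<xi> \<noteq> 0}" by (simp add: open_closed Compl_eq)
    moreover have "AE \<xi> in lborel. \<xi> \<notin> {\<xi>. F \<xi> \<noteq> 0}"
      using AE by eventually_elim (simp add: F_def)
    then have "{\<xi>. F \<xi> \<noteq> 0} \<in> null_sets lborel"
      using op by (intro AE_iff_null_sets[THEN iffD2]) auto
    then have "negligible {\<xi>. F \<xi> \<noteq> 0}"
      by (simp add: negligible_iff_null_sets null_sets_completionI)
    ultimately show False using open_not_negligible \<open>F \<xi> \<noteq> 0\<close> by blast
  qed
  then interpret van: vanishing_transform M h0 "\<lambda>x. x" r
    by unfold_locales (use h0 bd in \<open>auto simp: F_def h0_def split: if_splits\<close>)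
  have "(LINT x:A|M. h x) = 0" if "A \<in> sets borel" "A \<inter> At = {}" for A
  proof -
    have "(LINT x:A|M. h x) = (LINT x:((\<lambda>x. x) -` A \<inter> space M)|M. h0 x)"
      unfolding set_lebesgue_integral_def
      by (rule Bochner_Integration.integral_cong) (use that in \<open>auto simp: h0_def space indicator_def\<close>)
    then show ?thesis using van.integral_borel[OF that(1)] by simp
  qed
  with fin_At card_At show ?thesis by blast
qed

subsection \<open>Harmonic polynomials\<close>

text \<open>\<open>poly_fun\<close> sums over distinct exponents. Here exponents may repeat,
  coefficients being collected along the fibres of \<open>\<kappa>\<close>, which makes the closure
  properties easy.\<close>

lemma poly_fun_indexed:
  assumes "finite J"
  shows "poly_fun (\<lambda>x. \<Sum>j\<in>J. c j * (\<Prod>i\<in>UNIV. complex_of_real ((x $ i) ^ \<kappa> j i)))"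
proof -
  have "(\<Sum>j\<in>J. c j * (\<Prod>i\<in>UNIV. complex_of_real ((x $ i) ^ \<kappa> j i))) =
      (\<Sum>k\<in>\<kappa> ` J. (\<Sum>j | j \<in> J \<and> \<kappa> j = k. c j) * (\<Prod>i\<in>UNIV. complex_of_real ((x $ i) ^ k i)))" for x
    unfolding sum.image_gen[OF assms, of _ \<kappa>] by (auto simp: sum_distrib_right intro!: sum.cong)
  then show ?thesis
    unfolding poly_fun_def using assms by (intro exI[of _ "\<kappa> ` J"]) auto
qed

lemma poly_fun_const: "poly_fun (\<lambda>x. c)"
  using poly_fun_indexed[of "{()}" "\<lambda>_. c" "\<lambda>_ _. 0"] by simp

lemma poly_fun_coordinate: "poly_fun (\<lambda>x :: real^'n. complex_of_real (x $ i))"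
proof -
  have "(\<Prod>k\<in>UNIV. complex_of_real ((x $ k) ^ (if k = i then 1 else 0))) = of_real (x $ i)" for x :: "real^'n"
    by (subst prod.remove[of UNIV i]) (auto intro!: prod.neutral)
  then show ?thesis
    using poly_fun_indexed[of "{()}" "\<lambda>_. 1" "\<lambda>_ k. if k = i then 1 else 0"] by simp
qed

lemma poly_fun_add:
  assumes "poly_fun p" "poly_fun q"
  shows "poly_fun (\<lambda>x. p x + q x)"
proof -
  obtain K c where K: "finite K" "p = (\<lambda>x. \<Sum>k\<in>K. c k * (\<Prod>i\<in>UNIV. complex_of_real ((x $ i) ^ k i)))"
    using assms(1) unfolding poly_fun_def by blast
  obtain L d where L: "finite L" "q = (\<lambda>x. \<Sum>k\<in>L. d k * (\<Prod>i\<in>UNIV. complex_of_real ((x $ i) ^ k i)))"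
    using assms(2) unfolding poly_fun_def by blast
  have "(\<lambda>x. p x + q x) = (\<lambda>x. \<Sum>j\<in>K <+> L. case_sum c d j * (\<Prod>i\<in>UNIV. complex_of_real ((x $ i) ^ case_sum id id j i)))"
    using K L by (simp add: sum.Plus)
  then show ?thesis
    using poly_fun_indexed[of "K <+> L" "case_sum c d" "case_sum id id"] K(1) L(1) by simp
qed

lemma poly_fun_mult:
  assumes "poly_fun p" "poly_fun q"
  shows "poly_fun (\<lambda>x. p x * q x)"
proof -
  obtain K c where K: "finite K" "p = (\<lambda>x. \<Sum>k\<in>K. c k * (\<Prod>i\<in>UNIV. complex_of_real ((x $ i) ^ k i)))"
    using assms(1) unfolding poly_fun_def by blast
  obtain L d where L: "finite L" "q = (\<lambda>x. \<Sum>k\<in>L. d k * (\<Prod>i\<in>UNIV. complex_of_real ((x $ i) ^ k i)))"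
    using assms(2) unfolding poly_fun_def by blast
  have "(\<lambda>x. p x * q x) = (\<lambda>x. \<Sum>j\<in>K \<times> L. (c (fst j) * d (snd j)) *
      (\<Prod>i\<in>UNIV. complex_of_real ((x $ i) ^ (fst j i + snd j i))))"
    using K L by (simp add: sum_product sum.cartesian_product case_prod_unfold power_add prod.distrib mult_ac)
  then show ?thesis
    using poly_fun_indexed[of "K \<times> L" "\<lambda>j. c (fst j) * d (snd j)" "\<lambda>j i. fst j i + snd j i"] K(1) L(1)
    by simp
qed

lemma poly_fun_sum:
  assumes "\<And>i. i \<in> I \<Longrightarrow> poly_fun (p i)"
  shows "poly_fun (\<lambda>x. \<Sum>i\<in>I. p i x)"
  using assms by (induction I rule: infinite_finite_induct) (auto intro: poly_fun_const poly_fun_add)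

lemma continuous_on_poly_fun: "poly_fun p \<Longrightarrow> continuous_on S p"
  unfolding poly_fun_def by (auto intro!: continuous_intros)

lemma poly_fun_Complex_inner: "poly_fun (\<lambda>x. Complex (\<xi> \<bullet> x) (\<eta> \<bullet> x))"
proof -
  have "Complex (\<xi> \<bullet> x) (\<eta> \<bullet> x) = (\<Sum>i\<in>UNIV. Complex (\<xi> $ i) (\<eta> $ i) * of_real (x $ i))" for x
    by (simp add: complex_eq_iff inner_vec_def)
  then show ?thesis
    by (simp only:) (intro poly_fun_sum poly_fun_mult poly_fun_const poly_fun_coordinate)
qed

text \<open>The constant \<open>c\<close> and the equality of functions allow the rule to be applied
  twice in the Laplacian.\<close>

lemma partial_deriv_poly_linear:
  "partial_deriv i (\<lambda>x. c * poly p (Complex (\<xi> \<bullet> x) (\<eta> \<bullet> x))) =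
    (\<lambda>x. (c * Complex (\<xi> $ i) (\<eta> $ i)) * poly (pderiv p) (Complex (\<xi> \<bullet> x) (\<eta> \<bullet> x)))"
proof
  fix x
  let ?z = "Complex (\<xi> \<bullet> x) (\<eta> \<bullet> x)" and ?\<zeta> = "Complex (\<xi> $ i) (\<eta> $ i)"
  have lin: "Complex (\<xi> \<bullet> (x + t *\<^sub>R axis i 1)) (\<eta> \<bullet> (x + t *\<^sub>R axis i 1)) = ?z + of_real t * ?\<zeta>" for t
    by (simp add: complex_eq_iff inner_add_right inner_axis)
  have "((\<lambda>w. c * poly p (?z + w * ?\<zeta>)) has_field_derivative c * (poly (pderiv p) (?z + of_real 0 * ?\<zeta>) * ?\<zeta>)) (at (of_real 0))"
    by (intro DERIV_cmult DERIV_chain2[OF poly_DERIV]) (auto intro!: derivative_eq_intros)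
  then have "((\<lambda>t. c * poly p (?z + of_real t * ?\<zeta>)) has_vector_derivative c * (poly (pderiv p) (?z + of_real 0 * ?\<zeta>) * ?\<zeta>)) (at 0)"
    by (rule has_vector_derivative_real_field)
  then show "partial_deriv i (\<lambda>x. c * poly p (Complex (\<xi> \<bullet> x) (\<eta> \<bullet> x))) x =
    (c * ?\<zeta>) * poly (pderiv p) ?z"
    unfolding partial_deriv_def lin by (simp add: vector_derivative_at mult_ac)
qed

text \<open>The Laplacian is the second derivative of \<open>p\<close> times the sum of the squares
  of \<open>\<xi> $ i + \<i> * \<eta> $ i\<close>, and this sum vanishes for orthogonal vectors of
  equal length.\<close>

lemma harmonic_poly_isotropic:
  fixes \<xi> \<eta> :: "real^'n"
  assumes "\<xi> \<bullet> \<eta> = 0" "norm \<xi> = norm \<eta>"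
  shows "harmonic_poly (\<lambda>x. poly p (Complex (\<xi> \<bullet> x) (\<eta> \<bullet> x)))"
proof -
  have "poly_fun (\<lambda>x. poly p (Complex (\<xi> \<bullet> x) (\<eta> \<bullet> x)))"
    by (induction p) (auto intro!: poly_fun_const poly_fun_add poly_fun_mult poly_fun_Complex_inner)
  moreover have "laplacian (\<lambda>x. poly p (Complex (\<xi> \<bullet> x) (\<eta> \<bullet> x))) x = 0" for x
  proof -
    have "(\<Sum>i\<in>UNIV. Complex (\<xi> $ i) (\<eta> $ i) * Complex (\<xi> $ i) (\<eta> $ i)) =
        Complex (\<xi> \<bullet> \<xi> - \<eta> \<bullet> \<eta>) (2 * (\<xi> \<bullet> \<eta>))"
      by (simp add: complex_eq_iff inner_vec_def sum_subtractf sum_distrib_left mult_ac)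
    also have "\<dots> = 0" using assms by (simp add: complex_eq_iff power2_norm_eq_inner[symmetric])
    finally have iso: "(\<Sum>i\<in>UNIV. Complex (\<xi> $ i) (\<eta> $ i) * Complex (\<xi> $ i) (\<eta> $ i)) = 0" .
    have "laplacian (\<lambda>x. poly p (Complex (\<xi> \<bullet> x) (\<eta> \<bullet> x))) x =
        (\<Sum>i\<in>UNIV. Complex (\<xi> $ i) (\<eta> $ i) * Complex (\<xi> $ i) (\<eta> $ i)) * poly (pderiv (pderiv p)) (Complex (\<xi> \<bullet> x) (\<eta> \<bullet> x))"
      unfolding laplacian_def using partial_deriv_poly_linear[of _ 1 p \<xi> \<eta>] 
      by (simp add: partial_deriv_poly_linear sum_distrib_right)
    then show ?thesis using iso by simp
  qed
  ultimately show ?thesis unfolding harmonic_poly_def by blast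
qed

lemma isotropic_partner:
  fixes \<xi> :: "'e::euclidean_space"
  assumes "DIM('e) \<ge> 2"
  shows "\<exists>\<eta>. \<xi> \<bullet> \<eta> = 0 \<and> norm \<xi> = norm \<eta>"
proof -
  obtain y where y: "y \<noteq> 0" "\<xi> \<bullet> y = 0"
    using orthogonal_to_vector_exists[OF assms, of \<xi>] unfolding real_inner_class.orthogonal_def by blast
  then show ?thesis
    by (intro exI[of _ "(norm \<xi> / norm y) *\<^sub>R y"]) auto
qed

section \<open>From the matrix to harmonic moments, and the support of the measure\<close>

text \<open>An independent set of \<open>m\<close> rows is maximal and therefore spans all rows; so
  \<open>m + 1\<close> combinations of rows have coordinate vectors of length \<open>m\<close>,
  which are dependent.\<close>

lemma has_rank_dependent_rows:
  fixes H :: "'i \<Rightarrow> 'j \<Rightarrow> complex" and d :: "nat \<Rightarrow> 'i \<Rightarrow> complex"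
  assumes "has_rank H m"
  shows "\<exists>c. (\<exists>i\<le>m. c i \<noteq> 0) \<and> (\<forall>b. (\<Sum>i\<le>m. c i * (\<Sum>a\<in>S i. d i a * H a b)) = 0)"
proof -
  obtain S0 where S0: "rows_indep H S0" "card S0 = m"
    and max: "\<And>S. rows_indep H S \<Longrightarrow> card S \<le> m"
    using assms unfolding has_rank_def by blast
  have fin: "finite S0" using S0(1) by (simp add: rows_indep_def)
  have "\<exists>t. \<forall>b. H a b = (\<Sum>s\<in>S0. t s * H s b)" for a
  proof (cases "a \<in> S0")
    case True
    then show ?thesis using fin
      by (intro exI[of _ "\<lambda>s. if s = a then 1 else 0"])
         (auto simp: if_distrib[of "\<lambda>x. x * _"] sum.delta cong: if_cong)
  next
    case False
    then have "\<not> rows_indep H (insert a S0)"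
      using max[of "insert a S0"] fin S0(2) by auto
    then obtain c where c: "\<And>b. (\<Sum>s\<in>insert a S0. c s * H s b) = 0" "\<exists>s\<in>insert a S0. c s \<noteq> 0"
      using fin unfolding rows_indep_def by auto
    have c': "c a * H a b = - (\<Sum>s\<in>S0. c s * H s b)" for b
      using c(1)[of b] fin False by (simp add: eq_neg_iff_add_eq_0)
    have "c a \<noteq> 0"
    proof
      assume "c a = 0"
      then have "\<forall>b. (\<Sum>s\<in>S0. c s * H s b) = 0" using c' by simp
      then have "\<forall>s\<in>S0. c s = 0" using S0(1) unfolding rows_indep_def by blast
      with c(2) \<open>c a = 0\<close> show False by auto
    qed
    then have "H a b = (\<Sum>s\<in>S0. (- c s / c a) * H s b)" for b
      using c'[of b] by (simp add: sum_negf field_simps flip: sum_divide_distrib)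
    then show ?thesis by (intro exI[of _ "\<lambda>s. - c s / c a"] allI)
  qed
  then obtain t where t: "\<And>a b. H a b = (\<Sum>s\<in>S0. t a s * H s b)" by metis
  obtain \<sigma> where \<sigma>: "bij_betw \<sigma> {0..<m} S0"
    using ex_bij_betw_nat_finite[OF fin] S0(2) by auto
  define T where "T i s = (\<Sum>a\<in>S i. d i a * t a s)" for i s
  \<comment> \<open>The coordinates are padded to a square matrix by a zero column.\<close>
  have "sq_det (Suc m) (\<lambda>i j. if j < m then T i (\<sigma> j) else 0) = 0"
    by (rule sq_det_col_zero[of m]) auto
  then obtain v where v: "\<exists>i<Suc m. v i \<noteq> 0"
    "\<And>j. j < Suc m \<Longrightarrow> (\<Sum>i<Suc m. v i * (if j < m then T i (\<sigma> j) else 0)) = 0"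
    unfolding sq_det_eq_0_iff by blast
  have vT: "(\<Sum>i\<le>m. v i * T i s) = 0" if "s \<in> S0" for s
  proof -
    obtain j where "j < m" "s = \<sigma> j" using \<sigma> \<open>s \<in> S0\<close> by (auto simp: bij_betw_def)
    then show ?thesis using v(2)[of j] by (simp add: lessThan_Suc_atMost)
  qed
  have "(\<Sum>i\<le>m. v i * (\<Sum>a\<in>S i. d i a * H a b)) = 0" for b
  proof -
    have "(\<Sum>a\<in>S i. d i a * H a b) = (\<Sum>s\<in>S0. T i s * H s b)" for i
      by (subst t) (simp add: T_def sum_distrib_left sum_distrib_right mult.assoc sum.swap[of _ S0])
    then have "(\<Sum>i\<le>m. v i * (\<Sum>a\<in>S i. d i a * H a b)) = (\<Sum>s\<in>S0. (\<Sum>i\<le>m. v i * T i s) * H s b)"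
      by (simp add: sum_distrib_left sum_distrib_right mult.assoc sum.swap[of _ S0])
    then show ?thesis using vT by simp
  qed
  then show ?thesis using v(1) by (intro exI[of _ v]) (auto simp: less_Suc_eq_le)
qed

text \<open>Expanding each \<open>p i\<close> in the system gives combinations of rows of the
  matrix, and expanding \<open>g\<close> extends the relation to all columns. The conclusion is free
  of the chosen system.\<close>

lemma harmonic_moments_dependent:
  fixes M :: "(real^'n) measure" and h :: "real^'n \<Rightarrow> complex" and f :: "'i \<Rightarrow> real^'n \<Rightarrow> complex"
  assumes span: "spans_harmonic f" and rank: "has_rank (H_matrix M h f) m"
    and int: "\<And>p q. harmonic_poly p \<Longrightarrow> harmonic_poly q \<Longrightarrow> integrable M (\<lambda>x. p x * cnj (q x) * h x)"
    and p: "\<And>i :: nat. harmonic_poly (p i)"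
  shows "\<exists>c. (\<exists>i\<le>m. c i \<noteq> 0) \<and>
    (\<forall>g. harmonic_poly g \<longrightarrow> (\<Sum>i\<le>m. c i * (LINT x|M. p i x * cnj (g x) * h x)) = 0)"
proof -
  have f: "harmonic_poly (f a)" for a using span by (simp add: spans_harmonic_def)
  have "\<exists>S d. finite S \<and> p i = (\<lambda>x. \<Sum>a\<in>S. d a * f a x)" for i
    using span p[of i] unfolding spans_harmonic_def by blast
  then obtain S d where Sd: "\<And>i. finite (S i)" "\<And>i. p i = (\<lambda>x. \<Sum>a\<in>S i. d i a * f a x)"
    by metis
  obtain c where c: "\<exists>i\<le>m. c i \<noteq> 0"
    "\<And>b. (\<Sum>i\<le>m. c i * (\<Sum>a\<in>S i. d i a * H_matrix M h f a b)) = 0"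
    using has_rank_dependent_rows[OF rank, of d S] by blast
  have row: "(LINT x|M. p i x * cnj (f b x) * h x) = (\<Sum>a\<in>S i. d i a * H_matrix M h f a b)" for i b
  proof -
    have "(LINT x|M. p i x * cnj (f b x) * h x) = (LINT x|M. (\<Sum>a\<in>S i. d i a * (f a x * cnj (f b x) * h x)))"
      unfolding Sd(2) by (simp add: sum_distrib_right mult.assoc)
    also have "\<dots> = (\<Sum>a\<in>S i. d i a * H_matrix M h f a b)"
      unfolding H_matrix_def by (subst Bochner_Integration.integral_sum) (auto intro!: integrable_mult_right int f)
    finally show ?thesis .
  qed
  have "(\<Sum>i\<le>m. c i * (LINT x|M. p i x * cnj (g x) * h x)) = 0" if g: "harmonic_poly g" for g
  proof -
    obtain S' e where S': "finite S'" "g = (\<lambda>x. \<Sum>b\<in>S'. e b * f b x)"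
      using span g unfolding spans_harmonic_def by blast
    have "(LINT x|M. p i x * cnj (g x) * h x) = (\<Sum>b\<in>S'. cnj (e b) * (LINT x|M. p i x * cnj (f b x) * h x))" for i
    proof -
      have "(LINT x|M. p i x * cnj (g x) * h x) = (LINT x|M. (\<Sum>b\<in>S'. cnj (e b) * (p i x * cnj (f b x) * h x)))"
        unfolding S'(2) by (simp add: sum_distrib_left sum_distrib_right mult_ac)
      also have "\<dots> = (\<Sum>b\<in>S'. cnj (e b) * (LINT x|M. p i x * cnj (f b x) * h x))"
        by (subst Bochner_Integration.integral_sum) (auto intro!: integrable_mult_right int f p)
      finally show ?thesis .
    qed
    then have "(\<Sum>i\<le>m. c i * (LINT x|M. p i x * cnj (g x) * h x)) =
        (\<Sum>b\<in>S'. cnj (e b) * (\<Sum>i\<le>m. c i * (LINT x|M. p i x * cnj (f b x) * h x)))"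
      by (simp add: sum_distrib_left mult_ac sum.swap[of _ S'])
    then show ?thesis using c(2) by (simp add: row)
  qed
  then show ?thesis using c(1) by blast
qed

text \<open>Each point off the support has a ball all of whose Borel subsets have integral zero, so
  the density vanishes almost everywhere on it. By Lindelof countably many such open sets
  suffice.\<close>

lemma AE_zero_off_cmeasure_support:
  fixes M :: "(real^'n) measure"
  assumes fin: "finite_measure M" and sets: "sets M = sets borel" and h: "integrable M h"
  shows "AE x in M. x \<notin> cmeasure_support M h \<longrightarrow> h x = 0"
proof -
  interpret finite_measure M by (rule fin)
  define F where "F = {U. open U \<and> (AE x in M. x \<in> U \<longrightarrow> h x = 0)}"
  have "x \<in> \<Union>F" if "x \<notin> cmeasure_support M h" for x
  proof -
    obtain e where e: "e > 0" "\<And>A. A \<in> sets borel \<Longrightarrow> A \<subseteq> ball x e \<Longrightarrow> (LINT y:A|M. h y) = 0"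
      using \<open>x \<notin> cmeasure_support M h\<close> unfolding cmeasure_support_def by blast
    have ball: "ball x e \<in> sets M" by (simp add: sets)
    have "AE y in M. indicat_real (ball x e) y *\<^sub>R h y = 0"
    proof (rule density_zero)
      show "integrable M (\<lambda>y. indicat_real (ball x e) y *\<^sub>R h y)"
        by (intro integrable_mult_indicator ball h)
      fix A assume "A \<in> sets M"
      then have "(LINT y:A \<inter> ball x e|M. h y) = 0" by (intro e(2)) (auto simp: sets)
      then show "(LINT y:A|M. indicat_real (ball x e) y *\<^sub>R h y) = 0"
        by (simp add: set_lebesgue_integral_def indicator_inter_arith)
    qed
    then have "AE y in M. y \<in> ball x e \<longrightarrow> h y = 0" by eventually_elim auto
    then show ?thesis using e(1) unfolding F_def by (intro UnionI[of "ball x e"]) auto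
  qed
  then have cover: "- cmeasure_support M h \<subseteq> \<Union>F" by blast
  obtain F' where F': "F' \<subseteq> F" "countable F'" "\<Union>F' = \<Union>F"
    using Lindelof[of F] unfolding F_def by blast
  have "AE x in M. \<forall>U\<in>F'. x \<in> U \<longrightarrow> h x = 0"
    using F'(1,2) by (intro AE_ball_countable[THEN iffD2]) (auto simp: F_def)
  then show ?thesis by eventually_elim (use cover F'(3) in blast)
qed

theorem theorem5p6:
  fixes M :: "(real^'n) measure" and h :: "real^'n \<Rightarrow> complex"
    and f :: "'i \<Rightarrow> real^'n \<Rightarrow> complex" and m :: nat
  assumes "odd CARD('n)" and "CARD('n) \<ge> 3"
    and "finite_measure M" and "sets M = sets borel"
    and "integrable M h"
    and "compact (cmeasure_support M h)"
    and "spans_harmonic f"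
    and "has_rank (H_matrix M h f) m"
  shows "finite (cmeasure_support M h) \<and> card (cmeasure_support M h) \<le> m"
proof -
  interpret finite_measure M by fact
  have [measurable_cong]: "sets M = sets borel" by fact
  let ?K = "cmeasure_support M h"
  have K: "closed ?K" using \<open>compact ?K\<close> by (rule compact_imp_closed)
  then have [measurable]: "?K \<in> sets borel" by (rule borel_closed)
  have [measurable]: "h \<in> borel_measurable M" using \<open>integrable M h\<close> by simp
  \<comment> \<open>Cutting off to the support changes \<open>h\<close> only on a null set, and
    gives a bound at every point where the density is nonzero.\<close>
  define k where "k = (\<lambda>x. indicat_real ?K x *\<^sub>R h x)"
  have k: "integrable M k"
    unfolding k_def by (intro integrable_mult_indicator) (use assms in auto)
  have [measurable]: "k \<in> borel_measurable M" using k by simp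
  have hk: "AE x in M. h x = k x"
    using AE_zero_off_cmeasure_support[OF assms(3,4,5)]
    by eventually_elim (auto simp: k_def indicator_def)
  obtain r where r: "\<And>x. x \<in> ?K \<Longrightarrow> norm x \<le> r"
    using compact_imp_bounded[OF \<open>compact ?K\<close>] unfolding bounded_iff by blast
  have bd: "norm x \<le> r" if "k x \<noteq> 0" for x
    using r[of x] that by (auto simp: k_def indicator_def split: if_splits)
  have int: "integrable M (\<lambda>x. p x * cnj (q x) * k x)" if "harmonic_poly p" "harmonic_poly q" for p q
  proof (rule integrable_comp_mult[where T = "\<lambda>x. x", OF k _ bd])
    have "continuous_on UNIV p" "continuous_on UNIV q"
      using that by (auto simp: harmonic_poly_def intro: continuous_on_poly_fun)
    then show "continuous_on UNIV (\<lambda>x. p x * cnj (q x))" by (intro continuous_intros)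
  qed simp_all
  have harm: "harmonic_poly (f a)" for a
    using \<open>spans_harmonic f\<close> by (simp add: spans_harmonic_def)
  have [measurable]: "f a \<in> borel_measurable borel" for a
    using harm[of a] unfolding harmonic_poly_def
    by (intro borel_measurable_continuous_onI continuous_on_poly_fun) blast
  have "H_matrix M h f = H_matrix M k f"
    unfolding H_matrix_def fun_eq_iff
  proof (intro allI integral_cong_AE)
    have [measurable]: "cnj \<in> borel_measurable borel"
      by (intro borel_measurable_continuous_onI continuous_intros)
    fix a b
    show "AE x in M. f a x * cnj (f b x) * h x = f a x * cnj (f b x) * k x"
      using hk by eventually_elim simp
    show "(\<lambda>x. f a x * cnj (f b x) * h x) \<in> borel_measurable M"
      "(\<lambda>x. f a x * cnj (f b x) * k x) \<in> borel_measurable M"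
      by measurable
  qed
  then have rank: "has_rank (H_matrix M k f) m" using assms(8) by simp
  have "\<exists>\<eta> R. finite_rank_moments M k (\<lambda>x. Complex (\<xi> \<bullet> x) (\<eta> \<bullet> x)) R m" for \<xi>
  proof -
    obtain \<eta> where \<eta>: "\<xi> \<bullet> \<eta> = 0" "norm \<xi> = norm \<eta>"
      using isotropic_partner[of \<xi>] assms(2) by auto
    let ?z = "\<lambda>x. Complex (\<xi> \<bullet> x) (\<eta> \<bullet> x)"
    note z_harm = harmonic_poly_isotropic[OF \<eta>]
    have "finite_rank_moments M k ?z (norm \<xi> * r + norm \<eta> * r) m"
    proof
      have "continuous_on UNIV ?z"
        by (intro continuous_on_poly_fun poly_fun_Complex_inner)
      then show "?z \<in> borel_measurable M"
        using borel_measurable_continuous_onI by (simp cong: measurable_cong_sets add: assms(4)) 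
      fix x assume "k x \<noteq> 0"
      then have "norm x \<le> r" by (rule bd)
      then have "\<bar>\<xi> \<bullet> x\<bar> \<le> norm \<xi> * r" "\<bar>\<eta> \<bullet> x\<bar> \<le> norm \<eta> * r"
        by (auto intro!: order_trans[OF Cauchy_Schwarz_ineq2] mult_left_mono)
      then show "norm (?z x) \<le> norm \<xi> * r + norm \<eta> * r"
        using cmod_le[of "?z x"] by simp
    next
      fix p :: "nat \<Rightarrow> complex poly"
      show "\<exists>c. (\<exists>i\<le>m. c i \<noteq> 0) \<and> (\<forall>g. (\<Sum>i\<le>m. c i *
          (LINT x|M. poly (p i) (?z x) * cnj (poly g (?z x)) * k x)) = 0)"
        using harmonic_moments_dependent[OF assms(7) rank int, of "\<lambda>i x. poly (p i) (?z x)"] z_harm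
        by blast
    qed (rule k)
    then show ?thesis by blast
  qed
  then obtain At where At: "finite At" "card At \<le> m"
    and zero: "\<And>A. A \<in> sets borel \<Longrightarrow> A \<inter> At = {} \<Longrightarrow> (LINT x:A|M. k x) = 0"
    using finitely_supported_if_projections_finite_rank[OF assms(3,4) k bd, of m] by metis
  \<comment> \<open>A point outside the finite set \<open>At\<close> has a ball missing
    \<open>At\<close>, on whose Borel subsets the measure vanishes.\<close>
  have "?K \<subseteq> At"
  proof
    fix x assume x: "x \<in> ?K"
    show "x \<in> At"
    proof (rule ccontr)
      assume "x \<notin> At"
      then obtain e where e: "e > 0" "ball x e \<subseteq> - At"
        using finite_imp_closed[OF At(1)] unfolding closed_def open_contains_ball by blast
      obtain A where A: "A \<in> sets borel" "A \<subseteq> ball x e" "(LINT y:A|M. h y) \<noteq> 0"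
        using x e(1) unfolding cmeasure_support_def by blast
      have "(LINT y:A|M. h y) = (LINT y:A|M. k y)"
        unfolding set_lebesgue_integral_def
        by (intro integral_cong_AE) (use hk A(1) in \<open>auto elim!: eventually_mono\<close>)
      also have "\<dots> = 0" using A(1,2) e(2) by (intro zero) auto
      finally show False using A(3) by simp
    qed
  qed
  then show ?thesis using At card_mono finite_subset le_trans by metis
qed

end
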